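(* Let $d\ge1$ and let $\Sigma$ be a $d$-dimensional simplicial sphere (a simplicial complex homeomorphic to the $d$-sphere) with $n$ facets. Then $K_{d-1}(\Sigma)\cong\mathbb{Z}/n\mathbb{Z}$.
   Context: For a finite simplicial complex $\Delta$, $C_i(\Delta;\mathbb{Z})$ is the free abelian group on the $i$-dimensional faces (each with a fixed orientation), $\partial_i:C_i\to C_{i-1}$ is the simplicial boundary map, and $\partial^*_i$ is its transpose with respect to the standard bases. The $i$-dimensional critical group is $K_i(\Delta)=\ker\partial_i/\operatorname{im}(\partial_{i+1}\partial^*_{i+1})$. Facets are the $d$-dimensional faces. *)

theory Defs
  imports "HOL-Analysis.Analysis" "HOL-Algebra.Elementary_Groups" "HOL-Algebra.Coset"
begin

(* A finite abstract simplicial complex on a finite, linearly ordered vertex type.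
   Faces are vertex sets; the empty face (dimension -1) belongs to every nonempty complex. *)
definition simplicial_complex :: "('v::finite) set set \<Rightarrow> bool" where
  "simplicial_complex \<Delta> \<longleftrightarrow> (\<forall>\<sigma>\<in>\<Delta>. \<forall>\<tau>. \<tau> \<subseteq> \<sigma> \<longrightarrow> \<tau> \<in> \<Delta>)"

definition geom_realization :: "('v::finite) set set \<Rightarrow> (real^'v) set" where
  "geom_realization \<Delta> = (\<Union>\<sigma>\<in>\<Delta>. convex hull ((\<lambda>v. axis v 1) ` \<sigma>))"

definition faces :: "'v set set \<Rightarrow> nat \<Rightarrow> 'v set set" where
  "faces \<Delta> i = {\<sigma>\<in>\<Delta>. card \<sigma> = i + 1}"

(* faces with exactly i vertices, i.e. (i-1)-dimensional faces (i = 0: the empty face) *)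
definition lower_faces :: "'v set set \<Rightarrow> nat \<Rightarrow> 'v set set" where
  "lower_faces \<Delta> i = {\<tau>\<in>\<Delta>. card \<tau> = i}"

(* Orientation induced by the linear order of vertices:
   boundary of [v_0 < ... < v_k] is sum_j (-1)^j [v_0..^v_j..v_k]. *)
definition bdry_coeff :: "('v::linorder) set \<Rightarrow> 'v set \<Rightarrow> int" where
  "bdry_coeff \<sigma> \<tau> =
     (if \<tau> \<subseteq> \<sigma> \<and> card \<sigma> = Suc (card \<tau>)
      then (-1) ^ card {w\<in>\<sigma>. w < the_elem (\<sigma> - \<tau>)} else 0)"

definition chains :: "'v set set \<Rightarrow> nat \<Rightarrow> ('v set \<Rightarrow> int) set" where
  "chains \<Delta> i = {c. \<forall>\<sigma>. \<sigma> \<notin> faces \<Delta> i \<longrightarrow> c \<sigma> = 0}"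

definition chain_group :: "'v set set \<Rightarrow> nat \<Rightarrow> ('v set \<Rightarrow> int) monoid" where
  "chain_group \<Delta> i = \<lparr>carrier = chains \<Delta> i, monoid.mult = (\<lambda>x y \<sigma>. x \<sigma> + y \<sigma>), one = (\<lambda>_. 0)\<rparr>"

definition boundary :: "('v::linorder) set set \<Rightarrow> nat \<Rightarrow> ('v set \<Rightarrow> int) \<Rightarrow> ('v set \<Rightarrow> int)" where
  "boundary \<Delta> i c = (\<lambda>\<tau>. if \<tau> \<in> lower_faces \<Delta> i
                          then (\<Sum>\<sigma>\<in>faces \<Delta> i. bdry_coeff \<sigma> \<tau> * c \<sigma>) else 0)"

definition coboundary :: "('v::linorder) set set \<Rightarrow> nat \<Rightarrow> ('v set \<Rightarrow> int) \<Rightarrow> ('v set \<Rightarrow> int)" where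
  "coboundary \<Delta> i c = (\<lambda>\<sigma>. if \<sigma> \<in> faces \<Delta> i
                          then (\<Sum>\<tau>\<in>lower_faces \<Delta> i. bdry_coeff \<sigma> \<tau> * c \<tau>) else 0)"

definition cycles :: "('v::linorder) set set \<Rightarrow> nat \<Rightarrow> ('v set \<Rightarrow> int) set" where
  "cycles \<Delta> i = {c \<in> chains \<Delta> i. boundary \<Delta> i c = (\<lambda>_. 0)}"

definition laplacian_image :: "('v::linorder) set set \<Rightarrow> nat \<Rightarrow> ('v set \<Rightarrow> int) set" where
  "laplacian_image \<Delta> i = (\<lambda>c. boundary \<Delta> (i+1) (coboundary \<Delta> (i+1) c)) ` chains \<Delta> i"

definition critical_group :: "('v::linorder) set set \<Rightarrow> nat \<Rightarrow> ('v set \<Rightarrow> int) set monoid" where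
  "critical_group \<Delta> i = ((chain_group \<Delta> i)\<lparr>carrier := cycles \<Delta> i\<rparr>) Mod laplacian_image \<Delta> i"

end

theory Submission
  imports Defs "HOL-Library.Poly_Mapping"
begin

text \<open>
  Removing a facet \<open>\<sigma>\<close> from the sphere leaves a complex whose realization is a retract of a punctured
  sphere, hence contractible. A complex \<open>L\<close> with contractible realization has an acyclic augmented
  chain complex: replace simplices by tuples of nearby points. Acyclic carriers give chain maps from
  simplicial chains to fine tuple chains and back (sending a point to a vertex with large barycentric
  coordinate) whose composite is homotopic to the identity, while a contraction of \<open>|L|\<close>, sampled at
  finitely many times, makes every fine tuple cycle bound.

  Consequently \<open>L\<close> has a contracting chain homotopy. Applied to all facets this yields a cycle \<open>z\<close>
  with coefficients \<open>\<plusminus>1\<close> generating \<open>ker \<partial>\<^sub>d\<close>, the equality \<open>im \<partial>\<^sub>d = ker \<partial>\<^sub>d\<^sub>-\<^sub>1\<close>, and that the image of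
  \<open>\<partial>\<^sub>d\<^sup>*\<close> is the orthogonal complement of \<open>z\<close>. Therefore \<open>\<partial>e \<mapsto> \<langle>z, e\<rangle>\<close> identifies the critical group
  with the integers modulo \<open>\<langle>z, z\<rangle> = n\<close>.
\<close>

subsection \<open>Chain complexes with a basis of cells\<close>

text \<open>
  The grade is the dimension plus one: the empty tuple and the empty face have grade 0, so all
  complexes are augmented.
\<close>
class cell =
  fixes grade :: "'a \<Rightarrow> nat"
    and cell_bd :: "'a \<Rightarrow> 'a \<Rightarrow>\<^sub>0 int"
  assumes grade_keys_cell_bd: "b \<in> Poly_Mapping.keys (cell_bd a) \<Longrightarrow> Suc (grade b) = grade a"
    and frag_extend_cell_bd_cell_bd: "frag_extend cell_bd (cell_bd a) = 0"

abbreviation bd :: "('a::cell \<Rightarrow>\<^sub>0 int) \<Rightarrow> 'a \<Rightarrow>\<^sub>0 int" where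
  "bd \<equiv> frag_extend cell_bd"

lemma frag_extend_frag_of [simp]: "frag_extend frag_of c = c"
  using frag_expansion[of c] by simp

lemma frag_extend_frag_extend:
  "frag_extend f (frag_extend g c) = frag_extend (\<lambda>a. frag_extend f (g a)) c"
  using subset_UNIV
  by (induction c rule: frag_induction) (auto simp: frag_extend_diff)

lemma frag_extend_diff_fun:
  "frag_extend (\<lambda>a. f a - g a) c = frag_extend f c - frag_extend g c"
  using subset_UNIV
  by (induction c rule: frag_induction) (auto simp: frag_extend_diff)

lemma bd_bd [simp]: "bd (bd c) = 0"
  by (simp add: frag_extend_frag_extend frag_extend_cell_bd_cell_bd frag_extend_eq_0)

definition frag_chains :: "'a::cell set \<Rightarrow> nat \<Rightarrow> ('a \<Rightarrow>\<^sub>0 int) set" where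
  "frag_chains K p = {c. Poly_Mapping.keys c \<subseteq> {a \<in> K. grade a = p}}"

lemma frag_chains_zero [simp]: "0 \<in> frag_chains K p"
  by (simp add: frag_chains_def)

lemma frag_chains_frag_of [simp]: "frag_of a \<in> frag_chains K p \<longleftrightarrow> a \<in> K \<and> grade a = p"
  by (simp add: frag_chains_def)

lemma frag_chains_add: "c \<in> frag_chains K p \<Longrightarrow> e \<in> frag_chains K p \<Longrightarrow> c + e \<in> frag_chains K p"
  using keys_add[of c e] by (auto simp: frag_chains_def)

lemma frag_chains_diff: "c \<in> frag_chains K p \<Longrightarrow> e \<in> frag_chains K p \<Longrightarrow> c - e \<in> frag_chains K p"
  using keys_diff[of c e] by (auto simp: frag_chains_def)

lemma frag_chains_mono: "c \<in> frag_chains K p \<Longrightarrow> K \<subseteq> L \<Longrightarrow> c \<in> frag_chains L p"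
  by (auto simp: frag_chains_def)

lemma frag_chains_eq_zero:
  assumes "c \<in> frag_chains K p" "\<And>a. a \<in> K \<Longrightarrow> grade a \<noteq> p"
  shows "c = 0"
  using assms by (auto simp: frag_chains_def simp flip: keys_eq_empty)

lemma frag_extend_in_frag_chains:
  assumes "c \<in> frag_chains K p" "\<And>a. a \<in> K \<Longrightarrow> grade a = p \<Longrightarrow> f a \<in> frag_chains L q"
  shows "frag_extend f c \<in> frag_chains L q"
  using assms keys_frag_extend[of f c] by (fastforce simp: frag_chains_def)

lemma frag_extend_cong_frag_chains:
  assumes "c \<in> frag_chains K p" "\<And>a. a \<in> K \<Longrightarrow> grade a = p \<Longrightarrow> f a = g a"
  shows "frag_extend f c = frag_extend g c"
  using assms by (intro frag_extend_eq) (auto simp: frag_chains_def)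

lemma cell_bd_eq_zero: "grade a = 0 \<Longrightarrow> cell_bd a = 0"
  using grade_keys_cell_bd[of _ a] by (auto simp flip: keys_eq_empty)

lemma bd_eq_zero_grade_zero: "c \<in> frag_chains K 0 \<Longrightarrow> bd c = 0"
  by (rule frag_extend_eq_0) (auto simp: frag_chains_def cell_bd_eq_zero)

lemma cell_bd_in_frag_chains_keys:
  "cell_bd a \<in> frag_chains (Poly_Mapping.keys (cell_bd a)) (grade a - 1)"
  using grade_keys_cell_bd[of _ a] by (force simp: frag_chains_def)

definition subcomplex :: "'a::cell set \<Rightarrow> bool" where
  "subcomplex S \<longleftrightarrow> (\<forall>a\<in>S. Poly_Mapping.keys (cell_bd a) \<subseteq> S)"

lemma subcomplexD: "subcomplex S \<Longrightarrow> a \<in> S \<Longrightarrow> b \<in> Poly_Mapping.keys (cell_bd a) \<Longrightarrow> b \<in> S"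
  by (auto simp: subcomplex_def)

lemma cell_bd_in_frag_chains:
  assumes "subcomplex S" "a \<in> S" "grade a = Suc p"
  shows "cell_bd a \<in> frag_chains S p"
  using assms subcomplexD grade_keys_cell_bd[of _ a] by (fastforce simp: frag_chains_def)

lemma bd_in_frag_chains:
  assumes "subcomplex S" "c \<in> frag_chains S (Suc p)"
  shows "bd c \<in> frag_chains S p"
  using assms(2) by (rule frag_extend_in_frag_chains) (rule cell_bd_in_frag_chains[OF assms(1)])

definition acyclic_in :: "'a::cell set \<Rightarrow> 'a set \<Rightarrow> bool" where
  "acyclic_in K L \<longleftrightarrow>
     (\<forall>p. \<forall>c\<in>frag_chains K p. bd c = 0 \<longrightarrow> (\<exists>e\<in>frag_chains L (Suc p). bd e = c))"

abbreviation acyclic_on :: "'a::cell set \<Rightarrow> bool" where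
  "acyclic_on K \<equiv> acyclic_in K K"

lemma acyclic_inD:
  assumes "acyclic_in K L" "c \<in> frag_chains K p" "bd c = 0"
  obtains e where "e \<in> frag_chains L (Suc p)" "bd e = c"
  using assms unfolding acyclic_in_def by blast

subsection \<open>Acyclic carriers\<close>

definition acyclic_carrier :: "'a::cell set \<Rightarrow> ('a \<Rightarrow> 'b::cell set) \<Rightarrow> bool" where
  "acyclic_carrier S K \<longleftrightarrow>
     (\<forall>a\<in>S. (\<forall>b\<in>Poly_Mapping.keys (cell_bd a). K b \<subseteq> K a) \<and> (0 < grade a \<longrightarrow> acyclic_on (K a)))"

definition carried_chain_map ::
  "'a::cell set \<Rightarrow> ('a \<Rightarrow> 'b::cell set) \<Rightarrow> ('a \<Rightarrow> 'b \<Rightarrow>\<^sub>0 int) \<Rightarrow> bool" where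
  "carried_chain_map S K f \<longleftrightarrow>
     (\<forall>a\<in>S. f a \<in> frag_chains (K a) (grade a) \<and> bd (f a) = frag_extend f (cell_bd a))"

definition carried_homotopy ::
  "'a::cell set \<Rightarrow> ('a \<Rightarrow> 'b::cell set) \<Rightarrow> ('a \<Rightarrow> 'b \<Rightarrow>\<^sub>0 int) \<Rightarrow> ('a \<Rightarrow> 'b \<Rightarrow>\<^sub>0 int) \<Rightarrow>
    ('a \<Rightarrow> 'b \<Rightarrow>\<^sub>0 int) \<Rightarrow> bool" where
  "carried_homotopy S K f g h \<longleftrightarrow>
     (\<forall>a\<in>S. h a \<in> frag_chains (K a) (Suc (grade a)) \<and>
        bd (h a) = f a - g a - frag_extend h (cell_bd a))"

lemma acyclic_carrier_mono:
  "acyclic_carrier S K \<Longrightarrow> a \<in> S \<Longrightarrow> b \<in> Poly_Mapping.keys (cell_bd a) \<Longrightarrow> K b \<subseteq> K a"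
  by (auto simp: acyclic_carrier_def)

lemma carried_chain_map_zero: "carried_chain_map S K (\<lambda>_. 0)"
  by (simp add: carried_chain_map_def frag_extend_eq_0)

lemma carried_chain_map_frag_of:
  assumes "\<And>a. a \<in> S \<Longrightarrow> a \<in> K a"
  shows "carried_chain_map S K frag_of"
  using assms by (simp add: carried_chain_map_def)

lemma carried_chain_map_in_frag_chains:
  assumes "carried_chain_map S K f" "c \<in> frag_chains S p" "\<And>a. a \<in> S \<Longrightarrow> K a \<subseteq> L"
  shows "frag_extend f c \<in> frag_chains L p"
  using assms(2)
  by (rule frag_extend_in_frag_chains)
    (use assms(1,3) frag_chains_mono in \<open>force simp: carried_chain_map_def\<close>)

lemma carried_chain_map_bd:
  assumes "carried_chain_map S K f" "c \<in> frag_chains S p"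
  shows "bd (frag_extend f c) = frag_extend f (bd c)"
  unfolding frag_extend_frag_extend using assms(2)
  by (rule frag_extend_cong_frag_chains) (use assms(1) in \<open>simp add: carried_chain_map_def\<close>)

lemma carried_chain_map_compose:
  assumes map_f: "carried_chain_map S K f" and map_g: "carried_chain_map T L g"
    and carrier_subset: "\<And>a. a \<in> S \<Longrightarrow> K a \<subseteq> T"
    and carrier_compose: "\<And>a b. a \<in> S \<Longrightarrow> b \<in> K a \<Longrightarrow> L b \<subseteq> M a"
  shows "carried_chain_map S M (\<lambda>a. frag_extend g (f a))"
  unfolding carried_chain_map_def
proof (intro ballI conjI)
  fix a assume a_in_S: "a \<in> S"
  have f_a: "f a \<in> frag_chains (K a) (grade a)" "bd (f a) = frag_extend f (cell_bd a)"
    using map_f a_in_S by (auto simp: carried_chain_map_def)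
  have map_g_restricted: "carried_chain_map (K a) L g"
    using map_g carrier_subset[OF a_in_S] by (auto simp: carried_chain_map_def)
  show "frag_extend g (f a) \<in> frag_chains (M a) (grade a)"
    by (rule carried_chain_map_in_frag_chains[OF map_g_restricted f_a(1) carrier_compose[OF a_in_S]])
  show "bd (frag_extend g (f a)) = frag_extend (\<lambda>a. frag_extend g (f a)) (cell_bd a)"
    unfolding carried_chain_map_bd[OF map_g_restricted f_a(1)] f_a(2)
    by (rule frag_extend_frag_extend)
qed

lemma carried_homotopy_in_frag_chains:
  assumes "carried_homotopy S K f g h" "c \<in> frag_chains S p" "\<And>a. a \<in> S \<Longrightarrow> K a \<subseteq> L"
  shows "frag_extend h c \<in> frag_chains L (Suc p)"
  using assms(2)
  by (rule frag_extend_in_frag_chains)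
    (use assms(1,3) frag_chains_mono in \<open>force simp: carried_homotopy_def\<close>)

lemma carried_homotopy_bd_cycle:
  assumes "carried_homotopy S K f g h" "c \<in> frag_chains S p" "bd c = 0"
  shows "bd (frag_extend h c) = frag_extend f c - frag_extend g c"
proof -
  have "bd (frag_extend h c) = frag_extend (\<lambda>a. f a - g a - frag_extend h (cell_bd a)) c"
    unfolding frag_extend_frag_extend[of cell_bd h] using assms(2)
    by (rule frag_extend_cong_frag_chains) (use assms(1) in \<open>simp add: carried_homotopy_def\<close>)
  also have "\<dots> = frag_extend f c - frag_extend g c - frag_extend h (bd c)"
    by (simp add: frag_extend_diff_fun frag_extend_frag_extend)
  finally show ?thesis
    using assms(3) by simp
qed

lemma cell_recursive_choice:
  fixes Q :: "'a::cell \<Rightarrow> ('b \<Rightarrow>\<^sub>0 int) \<Rightarrow> ('b \<Rightarrow>\<^sub>0 int) \<Rightarrow> bool"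
  assumes subcomplex: "subcomplex S"
    and step: "\<And>h a. a \<in> S \<Longrightarrow>
      (\<And>b. b \<in> Poly_Mapping.keys (cell_bd a) \<Longrightarrow> Q b (h b) (frag_extend h (cell_bd b))) \<Longrightarrow>
      \<exists>e. Q a e (frag_extend h (cell_bd a))"
  shows "\<exists>h. \<forall>a\<in>S. Q a (h a) (frag_extend h (cell_bd a))"
proof -
  let ?R = "{(b, a::'a). b \<in> Poly_Mapping.keys (cell_bd a)}"
  let ?P = "\<lambda>h a e. a \<in> S \<longrightarrow> Q a e (frag_extend h (cell_bd a))"
  have "wf ?R"
    by (rule wf_subset[OF wf_measure[of grade]]) (auto dest: grade_keys_cell_bd)
  then have "\<exists>h. \<forall>a. ?P h a (h a)"
  proof (rule dependent_wf_choice)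
    fix h k :: "'a \<Rightarrow> 'b \<Rightarrow>\<^sub>0 int" and a e
    assume "\<And>b. (b, a) \<in> ?R \<Longrightarrow> h b = k b"
    then have "frag_extend h (cell_bd a) = frag_extend k (cell_bd a)"
      by (intro frag_extend_eq) auto
    then show "?P h a e = ?P k a e"
      by simp
  next
    fix a h
    assume "\<And>b. (b, a) \<in> ?R \<Longrightarrow> ?P h b (h b)"
    then show "\<exists>e. ?P h a e"
      using step[of a h] subcomplexD[OF subcomplex, of a] by simp
  qed
  then show ?thesis
    by blast
qed

lemma carried_chain_map_exists:
  assumes subcomplex: "subcomplex S" and carrier: "acyclic_carrier S K"
    and base_chain: "\<And>a. a \<in> S \<Longrightarrow> grade a = 0 \<Longrightarrow> f0 a \<in> frag_chains (K a) 0"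
  obtains f where "carried_chain_map S K f" "\<And>a. a \<in> S \<Longrightarrow> grade a = 0 \<Longrightarrow> f a = f0 a"
proof -
  let ?Q = "\<lambda>a e x. e \<in> frag_chains (K a) (grade a) \<and> bd e = x \<and> (grade a = 0 \<longrightarrow> e = f0 a)"
  have "\<exists>f. \<forall>a\<in>S. ?Q a (f a) (frag_extend f (cell_bd a))"
  proof (rule cell_recursive_choice[OF subcomplex, of ?Q])
    fix f and a :: 'a
    let ?F = "Poly_Mapping.keys (cell_bd a)"
    assume a_in_S: "a \<in> S" and faces: "\<And>b. b \<in> ?F \<Longrightarrow> ?Q b (f b) (frag_extend f (cell_bd b))"
    show "\<exists>e. ?Q a e (frag_extend f (cell_bd a))"
    proof (cases "grade a")
      case 0
      with base_chain[OF a_in_S] have "f0 a \<in> frag_chains (K a) 0"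
        by blast
      with 0 show ?thesis
        by (intro exI[of _ "f0 a"]) (simp add: cell_bd_eq_zero bd_eq_zero_grade_zero)
    next
      case (Suc p)
      have map_f: "carried_chain_map ?F K f"
        unfolding carried_chain_map_def using faces by blast
      have cell_bd_chain: "cell_bd a \<in> frag_chains ?F p"
        using cell_bd_in_frag_chains_keys[of a] Suc by simp
      have "frag_extend f (cell_bd a) \<in> frag_chains (K a) p"
        by (rule carried_chain_map_in_frag_chains
            [OF map_f cell_bd_chain acyclic_carrier_mono[OF carrier a_in_S]])
      moreover have "bd (frag_extend f (cell_bd a)) = 0"
        by (simp add: carried_chain_map_bd[OF map_f cell_bd_chain] frag_extend_cell_bd_cell_bd)
      moreover have "acyclic_on (K a)"
        using carrier a_in_S Suc by (simp add: acyclic_carrier_def)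
      ultimately obtain e where "e \<in> frag_chains (K a) (Suc p)" "bd e = frag_extend f (cell_bd a)"
        using acyclic_inD by blast
      with Suc show ?thesis
        by auto
    qed
  qed
  then obtain f where "\<forall>a\<in>S. ?Q a (f a) (frag_extend f (cell_bd a))"
    by blast
  then show thesis
    using that[of f] by (simp add: carried_chain_map_def)
qed

lemma carried_homotopy_exists:
  assumes subcomplex: "subcomplex S" and carrier: "acyclic_carrier S K"
    and map_f: "carried_chain_map S K f" and map_g: "carried_chain_map S K g"
    and agree: "\<And>a. a \<in> S \<Longrightarrow> grade a = 0 \<Longrightarrow> f a = g a \<or> acyclic_on (K a)"
  obtains h where "carried_homotopy S K f g h"
proof -
  let ?Q = "\<lambda>a e x. e \<in> frag_chains (K a) (Suc (grade a)) \<and> bd e = f a - g a - x"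
  have "\<exists>h. \<forall>a\<in>S. ?Q a (h a) (frag_extend h (cell_bd a))"
  proof (rule cell_recursive_choice[OF subcomplex, of ?Q])
    fix h and a :: 'a
    let ?F = "Poly_Mapping.keys (cell_bd a)"
    let ?t = "f a - g a - frag_extend h (cell_bd a)"
    assume a_in_S: "a \<in> S" and faces: "\<And>b. b \<in> ?F \<Longrightarrow> ?Q b (h b) (frag_extend h (cell_bd b))"
    show "\<exists>e. ?Q a e (frag_extend h (cell_bd a))"
    proof (cases "grade a = 0 \<and> f a = g a")
      case True
      then show ?thesis
        by (intro exI[of _ 0]) (simp add: cell_bd_eq_zero)
    next
      case False
      have f_g_chain_map: "f a \<in> frag_chains (K a) (grade a)" "g a \<in> frag_chains (K a) (grade a)"
        "bd (f a) = frag_extend f (cell_bd a)" "bd (g a) = frag_extend g (cell_bd a)"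
        using map_f map_g a_in_S by (auto simp: carried_chain_map_def)
      have homotopy: "carried_homotopy ?F K f g h"
        unfolding carried_homotopy_def using faces by blast
      have "frag_extend h (cell_bd a) \<in> frag_chains (K a) (grade a)"
        using carried_homotopy_in_frag_chains
          [OF homotopy cell_bd_in_frag_chains_keys acyclic_carrier_mono[OF carrier a_in_S]]
        by (cases "grade a = 0") (simp_all add: cell_bd_eq_zero)
      then have "?t \<in> frag_chains (K a) (grade a)"
        using f_g_chain_map(1,2) by (intro frag_chains_diff)
      moreover have "bd ?t = 0"
        using carried_homotopy_bd_cycle
          [OF homotopy cell_bd_in_frag_chains_keys frag_extend_cell_bd_cell_bd] f_g_chain_map(3,4)
        by (simp add: frag_extend_diff)
      moreover have "acyclic_on (K a)"
        using False agree[OF a_in_S] carrier a_in_S by (auto simp: acyclic_carrier_def)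
      ultimately show ?thesis
        using acyclic_inD by blast
    qed
  qed
  then show thesis
    using that unfolding carried_homotopy_def by blast
qed

lemma acyclic_on_iff_contracting_homotopy:
  assumes "subcomplex S"
  shows "acyclic_on S \<longleftrightarrow> (\<exists>h. carried_homotopy S (\<lambda>_. S) frag_of (\<lambda>_. 0) h)"
proof
  assume "acyclic_on S"
  then have "acyclic_carrier S (\<lambda>_. S)"
    by (simp add: acyclic_carrier_def)
  from carried_homotopy_exists[OF assms this carried_chain_map_frag_of carried_chain_map_zero]
  show "\<exists>h. carried_homotopy S (\<lambda>_. S) frag_of (\<lambda>_. 0) h"
    using \<open>acyclic_on S\<close> by blast
next
  assume "\<exists>h. carried_homotopy S (\<lambda>_. S) frag_of (\<lambda>_. 0) h"
  then obtain h where homotopy: "carried_homotopy S (\<lambda>_. S) frag_of (\<lambda>_. 0) h"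
    by blast
  show "acyclic_on S"
    unfolding acyclic_in_def
  proof (intro allI ballI impI)
    fix p and c :: "'a \<Rightarrow>\<^sub>0 int" assume cycle: "c \<in> frag_chains S p" "bd c = 0"
    have "frag_extend h c \<in> frag_chains S (Suc p)"
      by (rule carried_homotopy_in_frag_chains[OF homotopy cycle(1)]) simp
    moreover have "bd (frag_extend h c) = c"
      by (simp add: carried_homotopy_bd_cycle[OF homotopy cycle] frag_extend_eq_0)
    ultimately show "\<exists>e\<in>frag_chains S (Suc p). bd e = c"
      by blast
  qed
qed

lemma acyclic_on_if_homotopy_retract:
  assumes map_f: "carried_chain_map A F f" "\<And>a. a \<in> A \<Longrightarrow> F a \<subseteq> B"
    and map_g: "carried_chain_map C G g" "\<And>b. b \<in> C \<Longrightarrow> G b \<subseteq> A"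
    and homotopy: "carried_homotopy A H frag_of (\<lambda>a. frag_extend g (f a)) h" "\<And>a. a \<in> A \<Longrightarrow> H a \<subseteq> A"
    and bounding: "acyclic_in B C"
  shows "acyclic_on A"
  unfolding acyclic_in_def
proof (intro allI ballI impI)
  fix p and c :: "'a \<Rightarrow>\<^sub>0 int" assume cycle: "c \<in> frag_chains A p" "bd c = 0"
  have "frag_extend f c \<in> frag_chains B p"
    by (rule carried_chain_map_in_frag_chains[OF map_f(1) cycle(1) map_f(2)])
  moreover have "bd (frag_extend f c) = 0"
    by (simp add: carried_chain_map_bd[OF map_f(1) cycle(1)] cycle(2))
  ultimately obtain b where filling: "b \<in> frag_chains C (Suc p)" "bd b = frag_extend f c"
    using acyclic_inD[OF bounding] by blast
  have "frag_extend g b + frag_extend h c \<in> frag_chains A (Suc p)"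
    using carried_chain_map_in_frag_chains[OF map_g(1) filling(1) map_g(2)]
      carried_homotopy_in_frag_chains[OF homotopy(1) cycle(1) homotopy(2)] by (rule frag_chains_add)
  moreover have "bd (frag_extend g b + frag_extend h c) = c"
    using carried_chain_map_bd[OF map_g(1) filling(1)] carried_homotopy_bd_cycle[OF homotopy(1) cycle]
      filling(2)
    by (simp add: frag_extend_add frag_extend_frag_extend)
  ultimately show "\<exists>e\<in>frag_chains A (Suc p). bd e = c"
    by blast
qed

subsection \<open>Tuples\<close>

abbreviation list_cone :: "'a \<Rightarrow> ('a list \<Rightarrow>\<^sub>0 int) \<Rightarrow> 'a list \<Rightarrow>\<^sub>0 int" where
  "list_cone x \<equiv> frag_extend (\<lambda>l. frag_of (x # l))"

instantiation list :: (type) cell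
begin

definition [simp]: "grade_list \<equiv> length :: 'a list \<Rightarrow> nat"

primrec cell_bd_list :: "'a list \<Rightarrow> 'a list \<Rightarrow>\<^sub>0 int" where
  cell_bd_Nil: "cell_bd [] = (0 :: 'a list \<Rightarrow>\<^sub>0 int)"
| cell_bd_Cons: "cell_bd (x # xs) = frag_of xs - list_cone x (cell_bd xs)"

lemma frag_extend_cell_bd_list_cone:
  fixes c :: "'a list \<Rightarrow>\<^sub>0 int"
  shows "frag_extend cell_bd (list_cone x c) = c - list_cone x (frag_extend cell_bd c)"
  by (simp add: frag_extend_frag_extend frag_extend_diff_fun)

lemma keys_cell_bd_list:
  fixes k l :: "'a list"
  assumes "k \<in> Poly_Mapping.keys (cell_bd l)"
  shows "set k \<subseteq> set l \<and> Suc (length k) = length l"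
  using assms
proof (induction l arbitrary: k)
  case (Cons x xs)
  then have "k = xs \<or> k \<in> Poly_Mapping.keys (list_cone x (cell_bd xs))"
    using keys_diff[of "frag_of xs" "list_cone x (cell_bd xs)"] by auto
  then show ?case
    using Cons.IH keys_frag_extend[of "\<lambda>l. frag_of (x # l)" "cell_bd xs"] by fastforce
qed simp

instance
proof
  fix l :: "'a list"
  show "frag_extend cell_bd (cell_bd l) = 0"
    by (induction l) (simp_all add: frag_extend_diff frag_extend_cell_bd_list_cone)
qed (simp add: keys_cell_bd_list)

end

lemma set_keys_cell_bd: "k \<in> Poly_Mapping.keys (cell_bd l) \<Longrightarrow> set k \<subseteq> set l"
  using keys_cell_bd_list by blast

lemma subcomplex_lists: "subcomplex (lists X)"
  by (auto simp: subcomplex_def dest!: set_keys_cell_bd)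

lemma acyclic_on_lists:
  assumes "x \<in> X"
  shows "acyclic_on (lists X)"
proof -
  have "carried_homotopy (lists X) (\<lambda>_. lists X) frag_of (\<lambda>_. 0) (\<lambda>l. frag_of (x # l))"
    using assms by (simp add: carried_homotopy_def)
  then show ?thesis
    using acyclic_on_iff_contracting_homotopy[OF subcomplex_lists] by blast
qed

abbreviation list_chain_map :: "('a \<Rightarrow> 'b) \<Rightarrow> ('a list \<Rightarrow>\<^sub>0 int) \<Rightarrow> 'b list \<Rightarrow>\<^sub>0 int" where
  "list_chain_map f \<equiv> frag_extend (\<lambda>l. frag_of (map f l))"

lemma cell_bd_map: "cell_bd (map f l) = list_chain_map f (cell_bd l)"
  by (induction l) (simp_all add: frag_extend_diff frag_extend_frag_extend)

lemma bd_list_chain_map: "bd (list_chain_map f c) = list_chain_map f (bd c)"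
  by (simp add: frag_extend_frag_extend cell_bd_map)

lemma list_chain_map_cong:
  assumes "c \<in> frag_chains (lists X) p" "\<And>x. x \<in> X \<Longrightarrow> f x = g x"
  shows "list_chain_map f c = list_chain_map g c"
proof (rule frag_extend_cong_frag_chains[OF assms(1)])
  fix l assume "l \<in> lists X"
  with assms(2) have "map f l = map g l"
    by (auto intro: map_cong)
  then show "frag_of (map f l) = frag_of (map g l)"
    by (rule arg_cong)
qed

subsection \<open>Small tuples\<close>

definition small_lists :: "real \<Rightarrow> 'a::metric_space set \<Rightarrow> 'a list set" where
  "small_lists \<delta> X = {l. set l \<subseteq> X \<and> (\<forall>x\<in>set l. \<forall>y\<in>set l. dist x y < \<delta>)}"

lemma small_lists_mono: "X \<subseteq> Y \<Longrightarrow> \<delta> \<le> \<epsilon> \<Longrightarrow> small_lists \<delta> X \<subseteq> small_lists \<epsilon> Y"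
  by (fastforce simp: small_lists_def)

lemma small_lists_subset: "l \<in> small_lists \<delta> X \<Longrightarrow> set k \<subseteq> set l \<Longrightarrow> k \<in> small_lists \<delta> X"
  unfolding small_lists_def by blast

lemma small_lists_subset_lists: "small_lists \<delta> X \<subseteq> lists X"
  by (auto simp: small_lists_def)

lemma lists_singleton_subset_small_lists:
  assumes "x \<in> X" "\<delta> > 0"
  shows "lists {x} \<subseteq> small_lists \<delta> X"
proof
  fix l assume "l \<in> lists {x}"
  then have "set l = {} \<or> set l = {x}"
    by (intro subset_singletonD) auto
  with assms show "l \<in> small_lists \<delta> X"
    by (auto simp: small_lists_def)
qed

lemma list_chain_maps_homologous:
  assumes chain: "c \<in> frag_chains {l. map f l @ map g l \<in> small_lists \<delta> X} p" and cycle: "bd c = 0"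
  obtains b where "b \<in> frag_chains (small_lists \<delta> X) (Suc p)"
    "bd b = list_chain_map g c - list_chain_map f c"
proof -
  let ?S = "{l. map f l @ map g l \<in> small_lists \<delta> X}"
  let ?K = "\<lambda>l. lists (set (map f l @ map g l))"
  have subcomplex: "subcomplex ?S"
    unfolding subcomplex_def
  proof (intro ballI subsetI)
    fix l k assume "l \<in> ?S" "k \<in> Poly_Mapping.keys (cell_bd l)"
    moreover from this have "set k \<subseteq> set l"
      by (simp add: set_keys_cell_bd)
    ultimately show "k \<in> ?S"
      using small_lists_subset[of "map f l @ map g l" \<delta> X "map f k @ map g k"] by auto
  qed
  have carrier: "acyclic_carrier ?S ?K"
    unfolding acyclic_carrier_def
  proof (intro ballI conjI impI)
    fix l k :: "'a list" assume "k \<in> Poly_Mapping.keys (cell_bd l)"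
    then show "?K k \<subseteq> ?K l"
      by (intro lists_mono) (auto dest!: set_keys_cell_bd)
  next
    fix l :: "'a list" assume "0 < grade l"
    then show "acyclic_on (?K l)"
      by (intro acyclic_on_lists[of "f (hd l)"]) simp
  qed
  have "carried_chain_map ?S ?K (\<lambda>l. frag_of (map g l))"
    "carried_chain_map ?S ?K (\<lambda>l. frag_of (map f l))"
    by (auto simp: carried_chain_map_def cell_bd_map)
  from carried_homotopy_exists[OF subcomplex carrier this]
  obtain h where homotopy: "carried_homotopy ?S ?K (\<lambda>l. frag_of (map g l)) (\<lambda>l. frag_of (map f l)) h"
    by auto
  have "?K l \<subseteq> small_lists \<delta> X" if "l \<in> ?S" for l
    using that by (auto simp: small_lists_def)
  then show thesis
    using that[OF carried_homotopy_in_frag_chains[OF homotopy chain]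
        carried_homotopy_bd_cycle[OF homotopy chain cycle]]
    by blast
qed

lemma list_chain_map_sequence_homologous:
  fixes F :: "nat \<Rightarrow> 'a \<Rightarrow> 'b::metric_space"
  assumes "\<And>t. t < m \<Longrightarrow>
      c \<in> frag_chains {l. map (F t) l @ map (F (Suc t)) l \<in> small_lists \<delta> X} p"
    and cycle: "bd c = 0"
  shows "\<exists>b\<in>frag_chains (small_lists \<delta> X) (Suc p).
    bd b = list_chain_map (F m) c - list_chain_map (F 0) c"
  using assms(1)
proof (induction m)
  case (Suc m)
  then obtain b where homology: "b \<in> frag_chains (small_lists \<delta> X) (Suc p)"
      "bd b = list_chain_map (F m) c - list_chain_map (F 0) c"
    by auto
  obtain b' where homology_step: "b' \<in> frag_chains (small_lists \<delta> X) (Suc p)"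
      "bd b' = list_chain_map (F (Suc m)) c - list_chain_map (F m) c"
    using list_chain_maps_homologous[OF Suc.prems cycle] by blast
  show ?case
    by (rule bexI[OF _ frag_chains_add[OF homology_step(1) homology(1)]])
      (simp add: homology homology_step frag_extend_add)
qed (auto intro: bexI[of _ 0])

lemma small_cycle_bounds_if_discrete_contraction:
  fixes F :: "nat \<Rightarrow> 'a \<Rightarrow> 'a::metric_space"
  assumes cycle: "c \<in> frag_chains (lists X) p" "bd c = 0"
    and ends: "\<And>x. x \<in> X \<Longrightarrow> F 0 x = x" "\<And>x. x \<in> X \<Longrightarrow> F m x = x0"
    and base_point: "x0 \<in> X" "\<delta> > 0"
    and close: "\<And>i l. i < m \<Longrightarrow> l \<in> Poly_Mapping.keys c \<Longrightarrow>
      map (F i) l @ map (F (Suc i)) l \<in> small_lists \<delta> X"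
  shows "\<exists>e\<in>frag_chains (small_lists \<delta> X) (Suc p). bd e = c"
proof -
  have F_ends: "list_chain_map (F 0) c = c" "list_chain_map (F m) c = list_chain_map (\<lambda>_. x0) c"
    using list_chain_map_cong[OF cycle(1), of "F 0" id] list_chain_map_cong[OF cycle(1), of "F m" "\<lambda>_. x0"]
      ends by simp_all
  have "c \<in> frag_chains {l. map (F i) l @ map (F (Suc i)) l \<in> small_lists \<delta> X} p" if "i < m" for i
    using close[OF that] cycle(1) by (auto simp: frag_chains_def)
  then obtain b where homology: "b \<in> frag_chains (small_lists \<delta> X) (Suc p)"
      "bd b = list_chain_map (F m) c - list_chain_map (F 0) c"
    using list_chain_map_sequence_homologous[OF _ cycle(2)] by blast
  have const_chain: "list_chain_map (\<lambda>_. x0) c \<in> frag_chains (lists {x0}) p"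
    using cycle(1) by (rule frag_extend_in_frag_chains) auto
  have const_cycle: "bd (list_chain_map (\<lambda>_. x0) c) = 0"
    by (simp add: bd_list_chain_map cycle(2))
  obtain e where filling: "e \<in> frag_chains (lists {x0}) (Suc p)" "bd e = list_chain_map (\<lambda>_. x0) c"
    by (rule acyclic_inD[OF acyclic_on_lists[OF singletonI] const_chain const_cycle])
  have "e - b \<in> frag_chains (small_lists \<delta> X) (Suc p)"
    using frag_chains_mono[OF filling(1) lists_singleton_subset_small_lists[OF base_point]] homology(1)
    by (rule frag_chains_diff)
  moreover have "bd (e - b) = c"
    by (simp add: frag_extend_diff filling homology F_ends)
  ultimately show ?thesis
    by blast
qed

lemma small_cycle_bounds_if_contraction:
  fixes H :: "real \<Rightarrow> 'a \<Rightarrow> 'a::metric_space"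
  assumes cycle: "c \<in> frag_chains (lists X) p" "bd c = 0"
    and contraction: "\<And>x. x \<in> X \<Longrightarrow> H 0 x = x" "\<And>x. x \<in> X \<Longrightarrow> H 1 x = x0"
      "\<And>t x. t \<in> {0..1} \<Longrightarrow> x \<in> X \<Longrightarrow> H t x \<in> X"
    and base_point: "x0 \<in> X" "\<delta> > 0" "\<epsilon> > 0"
    and close: "\<And>l x y s t. l \<in> Poly_Mapping.keys c \<Longrightarrow> x \<in> set l \<Longrightarrow> y \<in> set l \<Longrightarrow>
        s \<in> {0..1} \<Longrightarrow> t \<in> {0..1} \<Longrightarrow> \<bar>s - t\<bar> < \<epsilon> \<Longrightarrow> dist (H s x) (H t y) < \<delta>"
  shows "\<exists>e\<in>frag_chains (small_lists \<delta> X) (Suc p). bd e = c"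
proof -
  obtain m :: nat where fine_steps: "m > 0" "1 / real m < \<epsilon>"
    using ex_inverse_of_nat_less[OF \<open>\<epsilon> > 0\<close>] by (auto simp: inverse_eq_divide)
  define F where "F i = H (real i / real m)" for i
  show ?thesis
  proof (rule small_cycle_bounds_if_discrete_contraction[OF cycle _ _ base_point(1,2), of F m])
    fix i l assume i_less: "i < m" and l_in_keys: "l \<in> Poly_Mapping.keys c"
    have times: "real i / real m \<in> {0..1}" "real (Suc i) / real m \<in> {0..1}"
      using i_less by auto
    have "\<bar>real i / real m - real (Suc i) / real m\<bar> < \<epsilon>"
      "\<bar>real (Suc i) / real m - real i / real m\<bar> < \<epsilon>"
      using fine_steps by (simp_all add: abs_minus_commute flip: diff_divide_distrib)
    then have "dist u v < \<delta>" if "u \<in> F i ` set l \<union> F (Suc i) ` set l"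
      "v \<in> F i ` set l \<union> F (Suc i) ` set l" for u v
      using that close[OF l_in_keys] times \<open>\<epsilon> > 0\<close> unfolding F_def by (auto simp del: of_nat_Suc)
    moreover have "set l \<subseteq> X"
      using cycle(1) l_in_keys by (auto simp: frag_chains_def)
    ultimately show "map (F i) l @ map (F (Suc i)) l \<in> small_lists \<delta> X"
      using contraction(3) times by (auto simp: small_lists_def F_def simp del: of_nat_Suc)
  qed (use contraction(1,2) fine_steps in \<open>auto simp: F_def\<close>)
qed

lemma small_lists_chain_diameter:
  assumes "c \<in> frag_chains (small_lists \<delta> X) p" "\<delta> > 0"
  obtains r where "r < \<delta>" "\<And>l x y. l \<in> Poly_Mapping.keys c \<Longrightarrow> x \<in> set l \<Longrightarrow> y \<in> set l \<Longrightarrow> dist x y \<le> r"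
proof
  let ?D = "insert 0 (\<Union>l\<in>Poly_Mapping.keys c. \<Union>x\<in>set l. dist x ` set l)"
  have "\<And>r. r \<in> ?D \<Longrightarrow> r < \<delta>"
    using assms by (auto simp: frag_chains_def small_lists_def)
  then show "Max ?D < \<delta>"
    by simp
  show "dist x y \<le> Max ?D" if "l \<in> Poly_Mapping.keys c" "x \<in> set l" "y \<in> set l" for l x y
    using that by (intro Max_ge) auto
qed

lemma dist_straight_line_contraction_le:
  fixes a x y :: "'a::real_normed_vector"
  assumes "s \<in> {0..1}"
  shows "dist ((1 - s) *\<^sub>R x + s *\<^sub>R a) ((1 - t) *\<^sub>R y + t *\<^sub>R a) \<le> dist x y + \<bar>s - t\<bar> * dist a y"
proof -
  have "((1 - s) *\<^sub>R x + s *\<^sub>R a) - ((1 - t) *\<^sub>R y + t *\<^sub>R a) = (1 - s) *\<^sub>R (x - y) + (s - t) *\<^sub>R (a - y)"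
    by (simp add: algebra_simps)
  then have "dist ((1 - s) *\<^sub>R x + s *\<^sub>R a) ((1 - t) *\<^sub>R y + t *\<^sub>R a)
      \<le> \<bar>1 - s\<bar> * dist x y + \<bar>s - t\<bar> * dist a y"
    using norm_triangle_ineq[of "(1 - s) *\<^sub>R (x - y)" "(s - t) *\<^sub>R (a - y)"]
    by (simp add: dist_norm)
  also have "\<bar>1 - s\<bar> * dist x y \<le> dist x y"
    using assms by (intro mult_left_le_one_le) auto
  finally show ?thesis
    by simp
qed

lemma acyclic_on_small_lists_convex:
  fixes X :: "'a::real_normed_vector set"
  assumes "convex X" "bounded X" "X \<noteq> {}" "\<delta> > 0"
  shows "acyclic_on (small_lists \<delta> X)"
  unfolding acyclic_in_def
proof (intro allI ballI impI)
  fix p and c :: "'a list \<Rightarrow>\<^sub>0 int" assume cycle: "c \<in> frag_chains (small_lists \<delta> X) p" "bd c = 0"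
  obtain a where a_in_X: "a \<in> X"
    using assms by blast
  obtain R where radius: "R > 0" "\<And>x. x \<in> X \<Longrightarrow> dist a x \<le> R"
    using assms(2) unfolding bounded_any_center[where a = a]
    by (metis dual_order.trans linorder_le_cases zero_less_one less_le_trans)
  obtain r where diameter: "r < \<delta>"
    "\<And>l x y. l \<in> Poly_Mapping.keys c \<Longrightarrow> x \<in> set l \<Longrightarrow> y \<in> set l \<Longrightarrow> dist x y \<le> r"
    using small_lists_chain_diameter[OF cycle(1) assms(4)] by blast
  define H where "H t x = (1 - t) *\<^sub>R x + t *\<^sub>R a" for t x
  have close: "dist (H s x) (H t y) < \<delta>"
    if "l \<in> Poly_Mapping.keys c" "x \<in> set l" "y \<in> set l" "s \<in> {0..1}" "t \<in> {0..1}"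
      "\<bar>s - t\<bar> < (\<delta> - r) / R" for l x y s t
  proof -
    have "dist (H s x) (H t y) \<le> dist x y + \<bar>s - t\<bar> * dist a y"
      unfolding H_def by (rule dist_straight_line_contraction_le[OF that(4)])
    also have "\<bar>s - t\<bar> * dist a y \<le> \<bar>s - t\<bar> * R"
      using that(1,3) cycle(1)
      by (intro mult_left_mono radius) (auto simp: frag_chains_def small_lists_def)
    also have "\<dots> < \<delta> - r"
      using that(6) radius(1) by (simp add: pos_less_divide_eq)
    finally show ?thesis
      using diameter(2)[OF that(1-3)] by simp
  qed
  show "\<exists>e\<in>frag_chains (small_lists \<delta> X) (Suc p). bd e = c"
  proof (rule small_cycle_bounds_if_contraction
      [where H = H and \<epsilon> = "(\<delta> - r) / R", OF _ cycle(2) _ _ _ a_in_X assms(4) _ close])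
    show "c \<in> frag_chains (lists X) p"
      by (rule frag_chains_mono[OF cycle(1) small_lists_subset_lists])
    show "H t x \<in> X" if "t \<in> {0..1}" "x \<in> X" for t x
      using that a_in_X assms(1) unfolding H_def by (intro convexD) auto
  qed (use diameter radius in \<open>auto simp: H_def\<close>)
qed

lemma compact_contractible_uniform_contraction:
  fixes X :: "'a::metric_space set"
  assumes "compact X" "contractible X" "X \<noteq> {}" "\<delta> > 0"
  obtains H :: "real \<Rightarrow> 'a \<Rightarrow> 'a" and a \<epsilon> where "a \<in> X" "\<epsilon> > 0"
    "\<And>x. x \<in> X \<Longrightarrow> H 0 x = x" "\<And>x. x \<in> X \<Longrightarrow> H 1 x = a"
    "\<And>t x. t \<in> {0..1} \<Longrightarrow> x \<in> X \<Longrightarrow> H t x \<in> X"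
    "\<And>s t x y. s \<in> {0..1} \<Longrightarrow> t \<in> {0..1} \<Longrightarrow> x \<in> X \<Longrightarrow> y \<in> X \<Longrightarrow>
      \<bar>s - t\<bar> < \<epsilon> \<Longrightarrow> dist x y < \<epsilon> \<Longrightarrow> dist (H s x) (H t y) < \<delta>"
proof -
  obtain a h where contraction: "continuous_on ({0..1::real} \<times> X) h" "h ` ({0..1} \<times> X) \<subseteq> X"
      "\<And>x. x \<in> X \<Longrightarrow> h (0, x) = x" "\<And>x. x \<in> X \<Longrightarrow> h (1, x) = a"
    using assms(2) by (auto simp: contractible_def homotopic_with image_subset_iff_funcset)
  have "uniformly_continuous_on ({0..1} \<times> X) h"
    by (intro compact_uniformly_continuous contraction compact_Times) (use assms in auto)
  then obtain \<epsilon> where modulus: "\<epsilon> > 0"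
    "\<And>u v. u \<in> {0..1} \<times> X \<Longrightarrow> v \<in> {0..1} \<times> X \<Longrightarrow> dist u v < \<epsilon> \<Longrightarrow> dist (h u) (h v) < \<delta>"
    unfolding uniformly_continuous_on_def using assms(4) by metis
  show thesis
  proof
    obtain x where "x \<in> X"
      using assms(3) by blast
    then show "a \<in> X"
      using contraction(4)[of x] contraction(2) by (auto simp: image_subset_iff)
    show "dist (h (s, x)) (h (t, y)) < \<delta>"
      if "s \<in> {0..1}" "t \<in> {0..1}" "x \<in> X" "y \<in> X" "\<bar>s - t\<bar> < \<epsilon> / 2" "dist x y < \<epsilon> / 2" for s t x y
    proof (rule modulus(2))
      have "dist (s, x) (t, y) \<le> dist s t + dist x y"
        unfolding dist_Pair_Pair by (rule sqrt_sum_squares_le_sum) simp_all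
      then show "dist (s, x) (t, y) < \<epsilon>"
        using that(5,6) by (simp add: dist_real_def)
    qed (use that in auto)
  qed (use contraction modulus(1) in auto)
qed

lemma acyclic_in_small_lists_contractible:
  fixes X :: "'a::metric_space set"
  assumes "compact X" "contractible X" "X \<noteq> {}" "\<delta> > 0"
  obtains \<epsilon> where "\<epsilon> > 0" "acyclic_in (small_lists \<epsilon> X) (small_lists \<delta> X)"
proof -
  obtain H :: "real \<Rightarrow> 'a \<Rightarrow> 'a" and a \<epsilon> where "a \<in> X" "\<epsilon> > 0"
    and contraction: "\<And>x. x \<in> X \<Longrightarrow> H 0 x = x" "\<And>x. x \<in> X \<Longrightarrow> H 1 x = a"
      "\<And>t x. t \<in> {0..1} \<Longrightarrow> x \<in> X \<Longrightarrow> H t x \<in> X"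
    and close: "\<And>s t x y. s \<in> {0..1} \<Longrightarrow> t \<in> {0..1} \<Longrightarrow> x \<in> X \<Longrightarrow> y \<in> X \<Longrightarrow>
      \<bar>s - t\<bar> < \<epsilon> \<Longrightarrow> dist x y < \<epsilon> \<Longrightarrow> dist (H s x) (H t y) < \<delta>"
    by (rule compact_contractible_uniform_contraction[OF assms]) (rule that)
  have "acyclic_in (small_lists \<epsilon> X) (small_lists \<delta> X)"
    unfolding acyclic_in_def
  proof (intro allI ballI impI)
    fix p and c :: "'a list \<Rightarrow>\<^sub>0 int"
    assume cycle: "c \<in> frag_chains (small_lists \<epsilon> X) p" "bd c = 0"
    show "\<exists>e\<in>frag_chains (small_lists \<delta> X) (Suc p). bd e = c"
    proof (rule small_cycle_bounds_if_contraction
        [OF _ cycle(2) contraction \<open>a \<in> X\<close> \<open>\<delta> > 0\<close> \<open>\<epsilon> > 0\<close>])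
      show "c \<in> frag_chains (lists X) p"
        by (rule frag_chains_mono[OF cycle(1) small_lists_subset_lists])
      show "dist (H s x) (H t y) < \<delta>"
        if "l \<in> Poly_Mapping.keys c" "x \<in> set l" "y \<in> set l" "s \<in> {0..1}" "t \<in> {0..1}" "\<bar>s - t\<bar> < \<epsilon>"
        for l x y s t
        by (rule close) (use that cycle(1) in \<open>auto simp: frag_chains_def small_lists_def\<close>)
    qed
  qed
  with \<open>\<epsilon> > 0\<close> show thesis
    using that by blast
qed

subsection \<open>Oriented simplices\<close>

abbreviation face_cone :: "'v \<Rightarrow> ('v set \<Rightarrow>\<^sub>0 int) \<Rightarrow> 'v set \<Rightarrow>\<^sub>0 int" where
  "face_cone m \<equiv> frag_extend (\<lambda>\<tau>. frag_of (insert m \<tau>))"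

instantiation set :: ("{finite,linorder}") cell
begin

definition [simp]: "grade_set \<equiv> card :: 'a set \<Rightarrow> nat"

definition cell_bd_set :: "'a set \<Rightarrow> 'a set \<Rightarrow>\<^sub>0 int" where
  "cell_bd \<sigma> = (\<Sum>v\<in>\<sigma>. frag_cmul ((-1) ^ card {w\<in>\<sigma>. w < v}) (frag_of (\<sigma> - {v} :: 'a set)))"

lemma lookup_cell_bd:
  fixes \<sigma> :: "'a set"
  shows "Poly_Mapping.lookup (cell_bd \<sigma>) \<tau> = bdry_coeff \<sigma> \<tau>"
proof -
  have lookup_sum_faces: "Poly_Mapping.lookup (cell_bd \<sigma>) \<tau> =
      (\<Sum>v\<in>\<sigma>. if \<sigma> - {v} = \<tau> then (-1) ^ card {w\<in>\<sigma>. w < v} else 0)"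
    by (auto simp: cell_bd_set_def lookup_sum lookup_single when_def intro!: sum.cong)
  show ?thesis
  proof (cases "\<tau> \<subseteq> \<sigma> \<and> card \<sigma> = Suc (card \<tau>)")
    case True
    then have "card (\<sigma> - \<tau>) = 1"
      by (simp add: card_Diff_subset)
    then obtain v where removed_vertex: "\<sigma> - \<tau> = {v}"
      by (rule card_1_singletonE)
    then have "\<sigma> - {u} = \<tau> \<longleftrightarrow> u = v" if "u \<in> \<sigma>" for u
      using True that by blast
    then have "Poly_Mapping.lookup (cell_bd \<sigma>) \<tau> =
        (\<Sum>u\<in>\<sigma>. if u = v then (-1) ^ card {w\<in>\<sigma>. w < v} else 0)"
      unfolding lookup_sum_faces by (intro sum.cong) auto
    then show ?thesis
      using True removed_vertex by (auto simp: bdry_coeff_def)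
  next
    case False
    then have "\<sigma> - {v} \<noteq> \<tau>" if "v \<in> \<sigma>" for v
      using that card_Suc_Diff1[of \<sigma> v] by auto
    then show ?thesis
      unfolding lookup_sum_faces bdry_coeff_def using False by (auto intro!: sum.neutral)
  qed
qed

lemma keys_cell_bd_set:
  fixes \<sigma> \<tau> :: "'a set"
  shows "\<tau> \<in> Poly_Mapping.keys (cell_bd \<sigma>) \<Longrightarrow> \<tau> \<subseteq> \<sigma> \<and> Suc (card \<tau>) = card \<sigma>"
  by (auto simp: in_keys_iff lookup_cell_bd bdry_coeff_def split: if_splits)

lemma cell_bd_insert_min:
  fixes \<sigma> :: "'a set"
  assumes m_less: "\<forall>v\<in>\<sigma>. m < v"
  shows "cell_bd (insert m \<sigma>) = frag_of \<sigma> - face_cone m (cell_bd \<sigma>)"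
proof -
  have "m \<notin> \<sigma>"
    using m_less by blast
  have "{w \<in> insert m \<sigma>. w < m} = {}" "insert m \<sigma> - {m} = \<sigma>"
    using m_less \<open>m \<notin> \<sigma>\<close> by (auto dest: less_asym)
  then have "cell_bd (insert m \<sigma>) = frag_of \<sigma> +
      (\<Sum>v\<in>\<sigma>. frag_cmul ((-1) ^ card {w\<in>insert m \<sigma>. w < v}) (frag_of (insert m \<sigma> - {v})))"
    unfolding cell_bd_set_def
    by (simp only: sum.insert[OF finite \<open>m \<notin> \<sigma>\<close>] card.empty power_0 frag_cmul_one)
  also have "\<dots> = frag_of \<sigma> -
      (\<Sum>v\<in>\<sigma>. frag_cmul ((-1) ^ card {w\<in>\<sigma>. w < v}) (frag_of (insert m (\<sigma> - {v}))))"
  proof -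
    have "frag_cmul ((-1) ^ card {w\<in>insert m \<sigma>. w < v}) (frag_of (insert m \<sigma> - {v})) =
        - frag_cmul ((-1) ^ card {w\<in>\<sigma>. w < v}) (frag_of (insert m (\<sigma> - {v})))" if "v \<in> \<sigma>" for v
    proof -
      have "{w \<in> insert m \<sigma>. w < v} = insert m {w \<in> \<sigma>. w < v}"
        and "insert m \<sigma> - {v} = insert m (\<sigma> - {v})"
        using m_less that by auto
      then show ?thesis
        using \<open>m \<notin> \<sigma>\<close> by simp
    qed
    then show ?thesis
      by (simp only: sum_negf diff_conv_add_uminus cong: sum.cong)
  qed
  finally show ?thesis
    by (simp add: cell_bd_set_def frag_extend_sum frag_extend_cmul)
qed

lemma frag_extend_cell_bd_face_cone:
  fixes c :: "'a set \<Rightarrow>\<^sub>0 int"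
  assumes "\<And>\<tau>. \<tau> \<in> Poly_Mapping.keys c \<Longrightarrow> \<forall>v\<in>\<tau>. m < v"
  shows "frag_extend cell_bd (face_cone m c) = c - face_cone m (frag_extend cell_bd c)"
proof -
  have "frag_extend cell_bd (face_cone m c) = frag_extend (\<lambda>\<tau>. frag_of \<tau> - face_cone m (cell_bd \<tau>)) c"
    unfolding frag_extend_frag_extend
    by (rule frag_extend_eq) (use assms in \<open>simp add: cell_bd_insert_min\<close>)
  then show ?thesis
    by (simp add: frag_extend_diff_fun frag_extend_frag_extend)
qed

instance
proof
  fix \<sigma> :: "'a set"
  show "frag_extend cell_bd (cell_bd \<sigma>) = 0"
  proof (induction \<sigma> rule: finite_linorder_min_induct[OF finite])
    case 1
    then show ?case
      by (simp add: cell_bd_set_def)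
  next
    case (2 m \<sigma>)
    have "frag_extend cell_bd (face_cone m (cell_bd \<sigma>)) =
        cell_bd \<sigma> - face_cone m (frag_extend cell_bd (cell_bd \<sigma>))"
      by (rule frag_extend_cell_bd_face_cone) (use 2 keys_cell_bd_set in blast)
    with 2 show ?case
      by (simp add: cell_bd_insert_min frag_extend_diff)
  qed
qed (simp add: keys_cell_bd_set)

end

lemma simplicial_complexD: "simplicial_complex \<Delta> \<Longrightarrow> \<sigma> \<in> \<Delta> \<Longrightarrow> \<tau> \<subseteq> \<sigma> \<Longrightarrow> \<tau> \<in> \<Delta>"
  by (auto simp: simplicial_complex_def)

lemma subcomplex_if_simplicial_complex: "simplicial_complex \<Delta> \<Longrightarrow> subcomplex \<Delta>"
  unfolding subcomplex_def using keys_cell_bd_set simplicial_complexD by blast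

lemma acyclic_on_Pow:
  fixes V :: "'v::{finite,linorder} set"
  assumes "V \<noteq> {}"
  shows "acyclic_on (Pow V)"
proof -
  define m where "m = Min V"
  have m_least: "m \<in> V" "\<And>v. v \<in> V \<Longrightarrow> v \<noteq> m \<Longrightarrow> m < v"
    using assms unfolding m_def by (auto simp: order_less_le)
  define h where "h \<tau> = (if m \<in> \<tau> then 0 else frag_of (insert m \<tau>))" for \<tau>
  have "bd (h \<tau>) = frag_of \<tau> - 0 - frag_extend h (cell_bd \<tau>)" if face: "\<tau> \<subseteq> V" for \<tau>
  proof (cases "m \<in> \<tau>")
    case True
    define \<rho> where "\<rho> = \<tau> - {m}"
    have insert_m: "\<tau> = insert m \<rho>" "\<forall>v\<in>\<rho>. m < v"
      using True face m_least(2) by (auto simp: \<rho>_def)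
    have "frag_extend h (face_cone m (cell_bd \<rho>)) = 0"
      unfolding frag_extend_frag_extend by (rule frag_extend_eq_0) (simp add: h_def)
    moreover have "h \<rho> = frag_of \<tau>" "h \<tau> = 0" "cell_bd \<tau> = frag_of \<rho> - face_cone m (cell_bd \<rho>)"
      using insert_m cell_bd_insert_min by (auto simp: h_def)
    ultimately show ?thesis
      by (simp add: frag_extend_diff)
  next
    case False
    then have "\<forall>v\<in>\<tau>. m < v"
      using face m_least(2) by blast
    moreover have "frag_extend h (cell_bd \<tau>) = face_cone m (cell_bd \<tau>)"
      by (rule frag_extend_eq) (use False keys_cell_bd_set in \<open>auto simp: h_def\<close>)
    ultimately show ?thesis
      using False by (simp add: h_def cell_bd_insert_min)
  qed
  moreover have "h \<tau> \<in> frag_chains (Pow V) (Suc (card \<tau>))" if "\<tau> \<subseteq> V" for \<tau>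
    using that m_least(1) by (simp add: h_def)
  ultimately have "carried_homotopy (Pow V) (\<lambda>_. Pow V) frag_of (\<lambda>_. 0) h"
    by (simp add: carried_homotopy_def)
  moreover have "subcomplex (Pow V)"
    by (rule subcomplex_if_simplicial_complex) (auto simp: simplicial_complex_def)
  ultimately show ?thesis
    using acyclic_on_iff_contracting_homotopy by blast
qed

lemma acyclic_carrier_Pow: "acyclic_carrier S (Pow :: 'v::{finite,linorder} set \<Rightarrow> 'v set set)"
  unfolding acyclic_carrier_def using keys_cell_bd_set by (auto intro!: acyclic_on_Pow)

subsection \<open>Geometric realizations\<close>

abbreviation simplex_of :: "'v::finite set \<Rightarrow> (real^'v) set" where
  "simplex_of \<sigma> \<equiv> convex hull ((\<lambda>v. axis v 1) ` \<sigma>)"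

definition vec_support :: "real^'v \<Rightarrow> 'v set" where
  "vec_support x = {v. x $ v \<noteq> 0}"

lemma sum_scaleR_axis:
  fixes x :: "real^'v"
  assumes "vec_support x \<subseteq> \<sigma>"
  shows "(\<Sum>v\<in>\<sigma>. x $ v *\<^sub>R axis v 1) = x"
proof (rule vec_eq_iff[THEN iffD2], rule allI)
  fix w
  have "(\<Sum>v\<in>\<sigma>. x $ v *\<^sub>R axis v (1::real)) $ w = (\<Sum>v\<in>\<sigma>. if v = w then x $ w else 0)"
    unfolding sum_component by (rule sum.cong) (auto simp: axis_def)
  then show "(\<Sum>v\<in>\<sigma>. x $ v *\<^sub>R axis v 1) $ w = x $ w"
    using assms by (auto simp: vec_support_def)
qed

lemma sum_vec_support:
  fixes x :: "real^'v"
  assumes "vec_support x \<subseteq> \<sigma>"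
  shows "(\<Sum>v\<in>\<sigma>. x $ v) = (\<Sum>v\<in>UNIV. x $ v)"
  by (rule sum.mono_neutral_left) (use assms in \<open>auto simp: vec_support_def\<close>)

lemma mem_simplex_iff:
  "x \<in> simplex_of \<sigma> \<longleftrightarrow> (\<forall>v. 0 \<le> x $ v) \<and> vec_support x \<subseteq> \<sigma> \<and> (\<Sum>v\<in>UNIV. x $ v) = 1"
proof
  let ?R = "{x::real^'a. (\<forall>v. 0 \<le> x $ v) \<and> (\<forall>v. v \<notin> \<sigma> \<longrightarrow> x $ v = 0) \<and> (\<Sum>v\<in>UNIV. x $ v) = 1}"
  assume "x \<in> simplex_of \<sigma>"
  moreover have "simplex_of \<sigma> \<subseteq> ?R"
  proof (rule hull_minimal)
    show "convex ?R"
      unfolding convex_def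
      by (auto simp: sum.distrib simp flip: sum_distrib_left intro: add_nonneg_nonneg)
  qed (auto simp: axis_def)
  ultimately show "(\<forall>v. 0 \<le> x $ v) \<and> vec_support x \<subseteq> \<sigma> \<and> (\<Sum>v\<in>UNIV. x $ v) = 1"
    unfolding vec_support_def by blast
next
  assume x_coords: "(\<forall>v. 0 \<le> x $ v) \<and> vec_support x \<subseteq> \<sigma> \<and> (\<Sum>v\<in>UNIV. x $ v) = 1"
  then have "(\<Sum>v\<in>\<sigma>. x $ v) = 1"
    using sum_vec_support[of x \<sigma>] by simp
  with x_coords have "(\<Sum>v\<in>\<sigma>. x $ v *\<^sub>R axis v 1) \<in> simplex_of \<sigma>"
    by (intro convex_sum) (auto intro: hull_inc)
  then show "x \<in> simplex_of \<sigma>"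
    using x_coords by (simp add: sum_scaleR_axis)
qed

lemma mem_geom_realization_iff:
  assumes "simplicial_complex \<Delta>"
  shows "x \<in> geom_realization \<Delta> \<longleftrightarrow>
    (\<forall>v. 0 \<le> x $ v) \<and> (\<Sum>v\<in>UNIV. x $ v) = 1 \<and> vec_support x \<in> \<Delta>"
  using simplicial_complexD[OF assms] by (auto simp: geom_realization_def mem_simplex_iff)

lemma compact_geom_realization: "compact (geom_realization \<Delta>)"
  unfolding geom_realization_def
  by (intro compact_UN finite compact_convex_hull finite_imp_compact) auto

subsection \<open>Complexes with contractible realization\<close>

definition dominant_vertex :: "real^'v::finite \<Rightarrow> 'v" where
  "dominant_vertex x = (SOME v. 1 / real CARD('v) \<le> x $ v)"

lemma dominant_vertex_ge:
  fixes x :: "real^'v::finite"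
  assumes "(\<Sum>v\<in>UNIV. x $ v) = 1"
  shows "1 / real CARD('v) \<le> x $ dominant_vertex x"
proof -
  have "\<exists>v. 1 / real CARD('v) \<le> x $ v"
  proof (rule ccontr)
    assume "\<nexists>v. 1 / real CARD('v) \<le> x $ v"
    then have "(\<Sum>v\<in>UNIV. x $ v) < (\<Sum>v\<in>(UNIV::'v set). 1 / real CARD('v))"
      by (intro sum_strict_mono) (auto simp: not_le)
    with assms show False
      by simp
  qed
  then show ?thesis
    unfolding dominant_vertex_def by (rule someI_ex)
qed

lemma dominant_vertex_in_simplex: "x \<in> simplex_of \<sigma> \<Longrightarrow> dominant_vertex x \<in> \<sigma>"
  using dominant_vertex_ge[of x] by (force simp: mem_simplex_iff vec_support_def)

lemma dominant_vertices_of_small_list: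
  fixes \<Delta> :: "'v::finite set set"
  assumes complex: "simplicial_complex \<Delta>" "{} \<in> \<Delta>"
    and small: "l \<in> small_lists (1 / real CARD('v)) (geom_realization \<Delta>)"
  shows "dominant_vertex ` set l \<in> \<Delta>"
proof (cases "l = []")
  case False
  then have hd_in_X: "hd l \<in> geom_realization \<Delta>"
    using small by (auto simp: small_lists_def)
  have "dominant_vertex x \<in> vec_support (hd l)" if "x \<in> set l" for x
  proof -
    have x_near_hd: "x \<in> geom_realization \<Delta>" "dist x (hd l) < 1 / real CARD('v)"
      using that small False by (auto simp: small_lists_def)
    then have "1 / real CARD('v) \<le> x $ dominant_vertex x"
      by (intro dominant_vertex_ge) (simp add: mem_geom_realization_iff[OF complex(1)])
    moreover have "\<bar>(x - hd l) $ dominant_vertex x\<bar> < 1 / real CARD('v)"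
      using component_le_norm_cart[of "x - hd l" "dominant_vertex x"] x_near_hd(2)
      by (simp add: dist_norm)
    ultimately show ?thesis
      by (auto simp: vec_support_def)
  qed
  moreover have "vec_support (hd l) \<in> \<Delta>"
    using hd_in_X by (simp add: mem_geom_realization_iff[OF complex(1)])
  ultimately show ?thesis
    by (blast intro: simplicial_complexD[OF complex(1)])
qed (simp add: complex(2))

lemma face_to_small_tuple_chain_map:
  fixes \<Delta> :: "'v::{finite,linorder} set set"
  assumes "subcomplex \<Delta>" "\<eta> > 0"
  obtains \<psi> where "carried_chain_map \<Delta> (\<lambda>\<sigma>. small_lists \<eta> (simplex_of \<sigma>)) \<psi>"
    "{} \<in> \<Delta> \<Longrightarrow> \<psi> {} = frag_of []"
proof -
  have "acyclic_carrier \<Delta> (\<lambda>\<sigma>. small_lists \<eta> (simplex_of \<sigma>))"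
    unfolding acyclic_carrier_def
  proof (intro ballI conjI impI)
    fix \<sigma> \<tau> :: "'v set" assume "\<tau> \<in> Poly_Mapping.keys (cell_bd \<sigma>)"
    then show "small_lists \<eta> (simplex_of \<tau>) \<subseteq> small_lists \<eta> (simplex_of \<sigma>)"
      by (intro small_lists_mono hull_mono image_mono) (simp_all add: keys_cell_bd_set)
  next
    fix \<sigma> :: "'v set" assume "0 < grade \<sigma>"
    then show "acyclic_on (small_lists \<eta> (simplex_of \<sigma>))"
      using assms(2)
      by (intro acyclic_on_small_lists_convex convex_convex_hull bounded_convex_hull finite_imp_bounded)
        auto
  qed
  from carried_chain_map_exists[OF assms(1) this, of "\<lambda>_. frag_of []"]
  show thesis
    using that by (auto simp: small_lists_def)
qed

lemma tuple_to_face_chain_map: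
  fixes f :: "'a \<Rightarrow> 'v::{finite,linorder}"
  obtains \<phi> where "carried_chain_map UNIV (\<lambda>l. Pow (f ` set l)) \<phi>" "\<phi> [] = frag_of {}"
proof -
  have "acyclic_carrier UNIV (\<lambda>l. Pow (f ` set l))"
    unfolding acyclic_carrier_def
  proof (intro ballI conjI impI)
    fix l k :: "'a list" assume "k \<in> Poly_Mapping.keys (cell_bd l)"
    then show "Pow (f ` set k) \<subseteq> Pow (f ` set l)"
      by (intro Pow_mono image_mono set_keys_cell_bd)
  qed (simp add: acyclic_on_Pow)
  from carried_chain_map_exists[OF _ this, of "\<lambda>_. frag_of {}"]
  show thesis
    using that by (auto simp: subcomplex_def)
qed

lemma acyclic_on_contractible_complex:
  fixes \<Delta> :: "'v::{finite,linorder} set set"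
  assumes complex: "simplicial_complex \<Delta>"
    and contractible: "contractible (geom_realization \<Delta>)" and nonempty: "geom_realization \<Delta> \<noteq> {}"
  shows "acyclic_on \<Delta>"
proof -
  let ?X = "geom_realization \<Delta>" and ?\<delta> = "1 / real CARD('v)"
  let ?Pow_dom = "\<lambda>l. Pow (dominant_vertex ` set l) :: 'v set set"
  obtain \<eta> where small_cycles_bound: "\<eta> > 0" "acyclic_in (small_lists \<eta> ?X) (small_lists ?\<delta> ?X)"
    using acyclic_in_small_lists_contractible[OF compact_geom_realization contractible nonempty, of ?\<delta>]
    by auto
  have subcomplex: "subcomplex \<Delta>"
    by (rule subcomplex_if_simplicial_complex[OF complex])
  have "{} \<in> \<Delta>"
    using nonempty simplicial_complexD[OF complex] by (auto simp: geom_realization_def)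
  obtain \<psi> where to_tuples: "carried_chain_map \<Delta> (\<lambda>\<sigma>. small_lists \<eta> (simplex_of \<sigma>)) \<psi>"
    "\<psi> {} = frag_of []"
    using face_to_small_tuple_chain_map[OF subcomplex small_cycles_bound(1)] \<open>{} \<in> \<Delta>\<close> by blast
  obtain \<phi> where to_faces: "carried_chain_map UNIV ?Pow_dom \<phi>" "\<phi> [] = frag_of {}"
    using tuple_to_face_chain_map by blast
  have "?Pow_dom l \<subseteq> Pow \<sigma>" if "l \<in> small_lists \<eta> (simplex_of \<sigma>)" for l \<sigma>
    using that dominant_vertex_in_simplex by (fastforce simp: small_lists_def)
  then have composite: "carried_chain_map \<Delta> Pow (\<lambda>\<sigma>. frag_extend \<phi> (\<psi> \<sigma>))"
    by (intro carried_chain_map_compose[OF to_tuples(1) to_faces(1)]) auto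
  obtain h where homotopy: "carried_homotopy \<Delta> Pow frag_of (\<lambda>\<sigma>. frag_extend \<phi> (\<psi> \<sigma>)) h"
    using carried_homotopy_exists[OF subcomplex acyclic_carrier_Pow carried_chain_map_frag_of composite]
    by (auto simp: to_tuples(2) to_faces(2))
  show ?thesis
  proof (rule acyclic_on_if_homotopy_retract[OF to_tuples(1) _ _ _ homotopy _ small_cycles_bound(2)])
    show "small_lists \<eta> (simplex_of \<sigma>) \<subseteq> small_lists \<eta> ?X" if "\<sigma> \<in> \<Delta>" for \<sigma>
      using that by (intro small_lists_mono) (auto simp: geom_realization_def)
    show "carried_chain_map (small_lists ?\<delta> ?X) ?Pow_dom \<phi>"
      using to_faces(1) by (simp add: carried_chain_map_def)
    show "?Pow_dom l \<subseteq> \<Delta>" if "l \<in> small_lists ?\<delta> ?X" for l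
      using dominant_vertices_of_small_list[OF complex \<open>{} \<in> \<Delta>\<close> that] simplicial_complexD[OF complex]
      by blast
  qed (use simplicial_complexD[OF complex] in blast)
qed

subsection \<open>Maximal faces\<close>

definition maximal_face :: "'v set set \<Rightarrow> 'v set \<Rightarrow> bool" where
  "maximal_face \<Delta> \<sigma> \<longleftrightarrow> \<sigma> \<in> \<Delta> \<and> (\<forall>\<tau>\<in>\<Delta>. \<sigma> \<subseteq> \<tau> \<longrightarrow> \<tau> = \<sigma>)"

lemma maximal_faceD:
  assumes "maximal_face \<Delta> \<sigma>"
  shows "\<sigma> \<in> \<Delta>" "\<tau> \<in> \<Delta> \<Longrightarrow> \<sigma> \<subseteq> \<tau> \<Longrightarrow> \<tau> = \<sigma>"
  using assms by (auto simp: maximal_face_def)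

lemma maximal_face_if_card_maximal:
  fixes \<Delta> :: "'v::finite set set"
  assumes "\<sigma> \<in> \<Delta>" "\<And>\<tau>. \<tau> \<in> \<Delta> \<Longrightarrow> card \<tau> \<le> card \<sigma>"
  shows "maximal_face \<Delta> \<sigma>"
  using assms card_seteq[OF finite] by (auto simp: maximal_face_def)

lemma maximal_face_superset:
  fixes \<Delta> :: "'v::finite set set"
  assumes "\<sigma> \<in> \<Delta>"
  obtains \<tau> where "maximal_face \<Delta> \<tau>" "\<sigma> \<subseteq> \<tau>"
proof -
  obtain \<tau> where "\<tau> \<in> \<Delta>" "\<sigma> \<subseteq> \<tau>" "\<forall>\<rho>\<in>\<Delta>. \<tau> \<subseteq> \<rho> \<longrightarrow> \<tau> = \<rho>"
    using finite_has_maximal2[OF finite assms] by blast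
  then show thesis
    using that[of \<tau>] by (auto simp: maximal_face_def)
qed

lemma simplicial_complex_remove_maximal_face:
  "simplicial_complex \<Delta> \<Longrightarrow> maximal_face \<Delta> \<sigma> \<Longrightarrow> simplicial_complex (\<Delta> - {\<sigma>})"
  unfolding simplicial_complex_def maximal_face_def by blast

definition barycenter :: "'v::finite set \<Rightarrow> real^'v" where
  "barycenter \<sigma> = (\<chi> v. if v \<in> \<sigma> then 1 / real (card \<sigma>) else 0)"

lemma barycenter_nth: "barycenter \<sigma> $ v = (if v \<in> \<sigma> then 1 / real (card \<sigma>) else 0)"
  by (simp add: barycenter_def)

lemma vec_support_barycenter [simp]: "vec_support (barycenter \<sigma>) = \<sigma>"
  by (auto simp: vec_support_def barycenter_nth)

lemma barycenter_in_simplex: "\<sigma> \<noteq> {} \<Longrightarrow> barycenter \<sigma> \<in> simplex_of \<sigma>"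
  by (auto simp: mem_simplex_iff barycenter_nth sum.If_cases)

lemma barycenter_in_geom_realization: "\<sigma> \<in> \<Delta> \<Longrightarrow> \<sigma> \<noteq> {} \<Longrightarrow> barycenter \<sigma> \<in> geom_realization \<Delta>"
  using barycenter_in_simplex by (auto simp: geom_realization_def)

lemma affine_independent_axis: "\<not> affine_dependent ((\<lambda>v. axis v (1::real)) ` \<sigma>)"
proof -
  have "(\<lambda>v. axis v (1::real)) ` \<sigma> \<subseteq> Basis"
    by (auto simp: Basis_vec_def)
  then have "independent ((\<lambda>v. axis v (1::real)) ` \<sigma>)"
    using independent_Basis independent_mono by blast
  then show ?thesis
    using affine_dependent_imp_dependent by blast
qed

lemma inj_on_axis: "inj_on (\<lambda>v. axis v (1::real)) \<sigma>"
  by (auto simp: inj_on_def axis_eq_axis)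

lemma aff_dim_affine_hull_simplex:
  "aff_dim (affine hull (simplex_of \<sigma>)) = int (card \<sigma>) - 1"
  using aff_dim_affine_independent[OF affine_independent_axis[of \<sigma>]]
  by (simp add: card_image inj_on_axis aff_dim_affine_hull affine_hull_convex_hull)

lemma rel_interior_simplex:
  "rel_interior (simplex_of \<sigma>) = {x \<in> simplex_of \<sigma>. vec_support x = \<sigma>}"
proof (intro equalityI subsetI)
  fix x :: "real^'a" assume "x \<in> rel_interior (simplex_of \<sigma>)"
  moreover from this obtain u where weights: "\<forall>y\<in>(\<lambda>v. axis v 1) ` \<sigma>. 0 < u y"
      "(\<Sum>y\<in>(\<lambda>v. axis v 1) ` \<sigma>. u y *\<^sub>R y) = x"
    unfolding rel_interior_convex_hull_explicit[OF affine_independent_axis] by auto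
  have "x $ v = u (axis v 1)" if "v \<in> \<sigma>" for v
  proof -
    have "x $ v = (\<Sum>w\<in>\<sigma>. u (axis w 1) * axis w 1 $ v)"
      unfolding weights(2)[symmetric] by (simp add: sum.reindex[OF inj_on_axis])
    also have "\<dots> = (\<Sum>w\<in>\<sigma>. if w = v then u (axis v 1) else 0)"
      by (rule sum.cong) (auto simp: axis_def)
    finally show ?thesis
      using that by simp
  qed
  then have "\<sigma> \<subseteq> vec_support x"
    using weights(1) by (force simp: vec_support_def)
  ultimately show "x \<in> {x \<in> simplex_of \<sigma>. vec_support x = \<sigma>}"
    using rel_interior_subset[of "simplex_of \<sigma>"] by (auto simp: mem_simplex_iff)
next
  fix x :: "real^'a" assume interior_point: "x \<in> {x \<in> simplex_of \<sigma>. vec_support x = \<sigma>}"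
  define u where "u y = x $ (THE v. y = axis v (1::real))" for y
  have weights: "u (axis v 1) = x $ v" for v
    by (simp add: u_def axis_eq_axis)
  have "\<forall>v\<in>\<sigma>. 0 < x $ v"
    using interior_point by (force simp: mem_simplex_iff vec_support_def order_less_le)
  then have "\<forall>y\<in>(\<lambda>v. axis v 1) ` \<sigma>. 0 < u y"
    by (auto simp: weights)
  moreover have "(\<Sum>y\<in>(\<lambda>v. axis v 1) ` \<sigma>. u y) = 1"
    using interior_point sum_vec_support[of x \<sigma>]
    by (simp add: sum.reindex[OF inj_on_axis] weights mem_simplex_iff)
  moreover have "(\<Sum>y\<in>(\<lambda>v. axis v 1) ` \<sigma>. u y *\<^sub>R y) = x"
    using interior_point sum_scaleR_axis[of x \<sigma>] by (simp add: sum.reindex[OF inj_on_axis] weights)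
  ultimately show "x \<in> rel_interior (simplex_of \<sigma>)"
    unfolding rel_interior_convex_hull_explicit[OF affine_independent_axis] by auto
qed

lemma openin_rel_interior_maximal_face:
  fixes \<Delta> :: "'v::finite set set"
  assumes complex: "simplicial_complex \<Delta>" and maximal: "maximal_face \<Delta> \<sigma>"
  shows "openin (top_of_set (geom_realization \<Delta>)) (rel_interior (simplex_of \<sigma>))"
proof -
  let ?P = "{x::real^'v. \<forall>v\<in>\<sigma>. 0 < x $ v}"
  have "?P = (\<Inter>v\<in>\<sigma>. {x. 0 < x $ v})"
    by auto
  then have "open ?P"
    by (auto intro!: open_INT open_Collect_less continuous_intros)
  moreover have "rel_interior (simplex_of \<sigma>) = geom_realization \<Delta> \<inter> ?P"
  proof (intro equalityI subsetI)
    fix x assume "x \<in> rel_interior (simplex_of \<sigma>)"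
    then have "x \<in> simplex_of \<sigma>" "vec_support x = \<sigma>"
      by (auto simp: rel_interior_simplex)
    then show "x \<in> geom_realization \<Delta> \<inter> ?P"
      using maximal_faceD(1)[OF maximal]
      by (auto simp: geom_realization_def mem_simplex_iff vec_support_def order_less_le)
  next
    fix x assume positive_point: "x \<in> geom_realization \<Delta> \<inter> ?P"
    then have "vec_support x = \<sigma>"
      by (intro maximal_faceD(2)[OF maximal])
        (auto simp: mem_geom_realization_iff[OF complex] vec_support_def)
    then show "x \<in> rel_interior (simplex_of \<sigma>)"
      using positive_point
      by (simp add: rel_interior_simplex mem_simplex_iff mem_geom_realization_iff[OF complex])
  qed
  ultimately show ?thesis
    by (simp add: openin_open_Int)
qed

subsection \<open>Triangulated spheres\<close>

lemma punctured_homeomorphic_affine: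
  fixes c :: "'b::euclidean_space"
  assumes "X homeomorphic sphere c r" "r > 0" "a \<in> X"
  obtains A :: "'b set" where "affine A" "A \<noteq> {}" "aff_dim A = int DIM('b) - 1" "X - {a} homeomorphic A"
proof -
  obtain f g where homeo: "homeomorphism X (sphere c r) f g"
    using assms(1) unfolding homeomorphic_def by blast
  have "inj_on f X"
    using homeo unfolding homeomorphism_def by (metis inj_on_inverseI)
  then have "f ` (X - {a}) = sphere c r - {f a}"
    using assms(3) homeo by (simp add: homeomorphism_def inj_on_image_set_diff)
  then have "homeomorphism (X - {a}) (sphere c r - {f a}) f g"
    by (intro homeomorphism_of_subsets[OF homeo]) auto
  then have "X - {a} homeomorphic sphere c r - {f a}"
    unfolding homeomorphic_def by blast
  also obtain i :: 'b where i_Basis: "i \<in> Basis"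
    using nonempty_Basis by blast
  have "sphere c r - {f a} homeomorphic {x. i \<bullet> x = 0}"
    by (rule homeomorphic_punctured_sphere_hyperplane)
      (use assms i_Basis homeo in \<open>auto simp: homeomorphism_def nonzero_Basis\<close>)
  finally have "X - {a} homeomorphic {x. i \<bullet> x = 0}" .
  moreover have "aff_dim {x. i \<bullet> x = 0} = int DIM('b) - 1"
    using nonzero_Basis[OF i_Basis] by (simp add: of_nat_diff Suc_leI)
  moreover have "{x. i \<bullet> x = 0} \<noteq> {}"
    using inner_zero_right[of i] by blast
  ultimately show thesis
    using that affine_hyperplane by blast
qed

lemma aff_dim_le_openin_homeomorphism:
  fixes U :: "'a::euclidean_space set" and V :: "'b::euclidean_space set"
  assumes "homeomorphism U V f g" "U \<noteq> {}" "affine A" "affine B"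
    and "openin (top_of_set A) U" "V \<subseteq> B"
  shows "aff_dim A \<le> aff_dim B"
proof (rule invariance_of_dimension_affine_sets[OF assms(5,3,4) _ _ _ assms(2)])
  show "continuous_on U f" "f \<in> U \<rightarrow> B"
    using assms(1,6) by (auto simp: homeomorphism_def)
  show "inj_on f U"
    using assms(1) unfolding homeomorphism_def by (metis inj_on_inverseI)
qed

lemma aff_dim_openin_homeomorphic_sphere:
  fixes c :: "'b::euclidean_space" and U :: "'a::euclidean_space set"
  assumes sphere: "X homeomorphic sphere c r" "r > 0"
    and open_in_X: "openin (top_of_set X) U" "U \<noteq> {}"
    and open_in_A: "affine A" "openin (top_of_set A) U"
  shows "aff_dim A = int DIM('b) - 1"
proof -
  obtain b where b_in_U: "b \<in> U"
    using open_in_X(2) by blast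
  then have "b \<in> X"
    using openin_imp_subset[OF open_in_X(1)] by blast
  then obtain C :: "'b set" where "C \<noteq> {}" "X - {b} homeomorphic C"
    using punctured_homeomorphic_affine[OF sphere] by blast
  then have "X - {b} \<noteq> {}"
    using homeomorphic_empty(2) by metis
  then obtain a where a_neq_b: "a \<in> X" "a \<noteq> b"
    by blast
  obtain B :: "'b set" where chart: "affine B" "aff_dim B = int DIM('b) - 1"
      "X - {a} homeomorphic B"
    using punctured_homeomorphic_affine[OF sphere a_neq_b(1)] by blast
  then obtain f g where chart_homeo: "homeomorphism (X - {a}) B f g"
    unfolding homeomorphic_def by blast
  let ?U = "U - {a}"
  have punctured_open: "openin (top_of_set (X - {a})) ?U" "openin (top_of_set A) ?U"
    using open_in_X(1) open_in_A(2) by (auto simp: openin_open)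
  have punctured_subset: "?U \<subseteq> X - {a}"
    using openin_imp_subset[OF open_in_X(1)] by blast
  have restricted_homeo: "homeomorphism ?U (f ` ?U) f g"
    by (rule homeomorphism_of_subsets[OF chart_homeo punctured_subset _ refl])
      (use chart_homeo punctured_subset in \<open>auto simp: homeomorphism_def\<close>)
  have "openin (top_of_set B) (f ` ?U)"
    by (rule homeomorphism_imp_open_map[OF chart_homeo punctured_open(1)])
  then have "aff_dim B \<le> aff_dim A"
    using b_in_U a_neq_b(2) open_in_A punctured_open(2) chart
    by (intro aff_dim_le_openin_homeomorphism[OF homeomorphism_symD[OF restricted_homeo]])
      (auto dest: openin_imp_subset)
  moreover have "aff_dim A \<le> aff_dim B"
    using b_in_U a_neq_b(2) open_in_A punctured_open(2) chart chart_homeo punctured_subset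
    by (intro aff_dim_le_openin_homeomorphism[OF restricted_homeo]) (auto simp: homeomorphism_def)
  ultimately show ?thesis
    using chart(2) by simp
qed

lemma card_maximal_face_sphere:
  fixes \<Delta> :: "'v::finite set set"
  assumes complex: "simplicial_complex \<Delta>"
    and sphere: "geom_realization \<Delta> homeomorphic sphere (c::'b::euclidean_space) r" "r > 0"
    and maximal: "maximal_face \<Delta> \<sigma>"
  shows "card \<sigma> = DIM('b)"
proof -
  have "geom_realization \<Delta> \<noteq> {}"
    using sphere homeomorphic_empty(2) by fastforce
  then obtain x where "x \<in> geom_realization \<Delta>"
    by blast
  then have "vec_support x \<in> \<Delta>" "vec_support x \<noteq> {}"
    using sum_vec_support[of x "{}"] by (auto simp: mem_geom_realization_iff[OF complex])
  then have "\<sigma> \<noteq> {}"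
    using maximal_faceD(2)[OF maximal] by blast
  then have "barycenter \<sigma> \<in> rel_interior (simplex_of \<sigma>)"
    by (simp add: rel_interior_simplex barycenter_in_simplex)
  then have "aff_dim (affine hull (simplex_of \<sigma>)) = int DIM('b) - 1"
    by (intro aff_dim_openin_homeomorphic_sphere[OF sphere
          openin_rel_interior_maximal_face[OF complex maximal]])
      (use openin_rel_interior[of "simplex_of \<sigma>"] in auto)
  then show ?thesis
    using aff_dim_affine_hull_simplex[of \<sigma>] by simp
qed

lemma continuous_on_Min:
  fixes f :: "'i \<Rightarrow> 'a::topological_space \<Rightarrow> real"
  assumes "finite I" "I \<noteq> {}" "\<And>i. i \<in> I \<Longrightarrow> continuous_on S (f i)"
  shows "continuous_on S (\<lambda>x. Min ((\<lambda>i. f i x) ` I))"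
  using assms
proof (induction I rule: finite_ne_induct)
  case (insert i I)
  then have "continuous_on S (\<lambda>x. min (f i x) (Min ((\<lambda>i. f i x) ` I)))"
    by (intro continuous_on_min) auto
  with insert show ?case
    by simp
qed simp

definition min_coord :: "'v::finite set \<Rightarrow> real^'v \<Rightarrow> real" where
  "min_coord \<sigma> x = Min ((\<lambda>v. x $ v) ` \<sigma>)"

lemma min_coord_le: "v \<in> \<sigma> \<Longrightarrow> min_coord \<sigma> x \<le> x $ v"
  by (auto simp: min_coord_def)

lemma min_coord_attained:
  assumes "\<sigma> \<noteq> {}"
  obtains v where "v \<in> \<sigma>" "min_coord \<sigma> x = x $ v"
proof -
  have "min_coord \<sigma> x \<in> (\<lambda>v. x $ v) ` \<sigma>"
    unfolding min_coord_def using assms by (intro Min_in) auto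
  then show thesis
    using that by blast
qed

lemma min_coord_eq_zero:
  assumes "\<And>v. 0 \<le> x $ v" "\<not> \<sigma> \<subseteq> vec_support x"
  shows "min_coord \<sigma> x = 0"
proof -
  obtain v where zero_coord: "v \<in> \<sigma>" "x $ v = 0"
    using assms(2) by (auto simp: vec_support_def)
  obtain w where least_coord: "w \<in> \<sigma>" "min_coord \<sigma> x = x $ w"
    using min_coord_attained zero_coord(1) by blast
  show ?thesis
    using min_coord_le[OF zero_coord(1), of x] assms(1)[of w] zero_coord(2) least_coord(2) by simp
qed

lemma card_mult_min_coord_less_1:
  assumes x_coords: "\<And>v. 0 \<le> x $ v" "(\<Sum>v\<in>UNIV. x $ v) = 1" "x \<noteq> barycenter \<sigma>" and nonempty: "\<sigma> \<noteq> {}"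
  shows "real (card \<sigma>) * min_coord \<sigma> x < 1"
proof (rule ccontr)
  assume "\<not> real (card \<sigma>) * min_coord \<sigma> x < 1"
  then have "1 / real (card \<sigma>) \<le> min_coord \<sigma> x"
    using nonempty by (simp add: field_simps card_gt_0_iff)
  then have nonneg: "0 \<le> x $ v - barycenter \<sigma> $ v" for v
    using min_coord_le[of v \<sigma> x] x_coords(1)[of v] by (auto simp: barycenter_nth)
  have "(\<Sum>v\<in>UNIV. x $ v - barycenter \<sigma> $ v) = 0"
    using x_coords(2) barycenter_in_simplex[OF nonempty]
    by (simp add: sum_subtractf mem_simplex_iff)
  then have "x $ v - barycenter \<sigma> $ v = 0" for v
    using nonneg by (simp add: sum_nonneg_eq_0_iff)
  then have "x = barycenter \<sigma>"
    by (simp add: vec_eq_iff)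
  with x_coords(3) show False ..
qed

text \<open>On the simplex this is the radial projection from its barycenter onto its boundary.\<close>
definition push_off :: "'v::finite set \<Rightarrow> real^'v \<Rightarrow> real^'v" where
  "push_off \<sigma> x = (1 / (1 - real (card \<sigma>) * min_coord \<sigma> x)) *\<^sub>R
     (x - min_coord \<sigma> x *\<^sub>R (\<chi> v. if v \<in> \<sigma> then 1 else 0))"

lemma push_off_nth:
  "push_off \<sigma> x $ v = (x $ v - (if v \<in> \<sigma> then min_coord \<sigma> x else 0)) / (1 - real (card \<sigma>) * min_coord \<sigma> x)"
  by (simp add: push_off_def)

lemma push_off_in_geom_realization:
  fixes \<Delta> :: "'v::finite set set"
  assumes complex: "simplicial_complex \<Delta>" and maximal: "maximal_face \<Delta> \<sigma>" and nonempty: "\<sigma> \<noteq> {}"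
    and punctured_point: "x \<in> geom_realization \<Delta>" "x \<noteq> barycenter \<sigma>"
  shows "push_off \<sigma> x \<in> geom_realization (\<Delta> - {\<sigma>})"
proof -
  have complex_removed: "simplicial_complex (\<Delta> - {\<sigma>})"
    by (rule simplicial_complex_remove_maximal_face[OF complex maximal])
  have x_coords: "\<And>v. 0 \<le> x $ v" "(\<Sum>v\<in>UNIV. x $ v) = 1" "vec_support x \<in> \<Delta>"
    using punctured_point(1) by (auto simp: mem_geom_realization_iff[OF complex])
  have denominator_pos: "0 < 1 - real (card \<sigma>) * min_coord \<sigma> x"
    using card_mult_min_coord_less_1[OF x_coords(1,2) punctured_point(2) nonempty] by simp
  obtain w where least_coord: "w \<in> \<sigma>" "min_coord \<sigma> x = x $ w"
    by (rule min_coord_attained[OF nonempty])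
  have "0 \<le> push_off \<sigma> x $ v" for v
    using denominator_pos x_coords min_coord_le[of v \<sigma> x] by (simp add: push_off_nth)
  moreover have "(\<Sum>v\<in>UNIV. push_off \<sigma> x $ v) = 1"
    using denominator_pos x_coords(2)
    by (simp add: push_off_nth sum_subtractf sum.If_cases flip: sum_divide_distrib)
  moreover have "vec_support (push_off \<sigma> x) \<subseteq> vec_support x"
    using min_coord_le[of _ \<sigma> x] x_coords(1)[of w] least_coord
    by (fastforce simp: vec_support_def push_off_nth split: if_splits)
  then have "vec_support (push_off \<sigma> x) \<in> \<Delta>"
    by (rule simplicial_complexD[OF complex x_coords(3)])
  moreover have "w \<notin> vec_support (push_off \<sigma> x)"
    using least_coord by (simp add: vec_support_def push_off_nth)
  ultimately show ?thesis
    using least_coord(1) by (auto simp: mem_geom_realization_iff[OF complex_removed])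
qed

lemma push_off_eq_self:
  assumes "x \<in> geom_realization (\<Delta> - {\<sigma>})" "simplicial_complex \<Delta>" "maximal_face \<Delta> \<sigma>"
  shows "push_off \<sigma> x = x"
proof -
  have x_coords: "\<And>v. 0 \<le> x $ v" "vec_support x \<in> \<Delta> - {\<sigma>}"
    using assms(1) by (auto simp: mem_geom_realization_iff
      [OF simplicial_complex_remove_maximal_face[OF assms(2,3)]])
  then have "\<not> \<sigma> \<subseteq> vec_support x"
    using maximal_faceD(2)[OF assms(3)] by blast
  then show ?thesis
    using min_coord_eq_zero[OF x_coords(1)] by (simp add: push_off_def)
qed

lemma retract_punctured_geom_realization:
  fixes \<Delta> :: "'v::finite set set"
  assumes complex: "simplicial_complex \<Delta>" and maximal: "maximal_face \<Delta> \<sigma>" and nonempty: "\<sigma> \<noteq> {}"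
  shows "geom_realization (\<Delta> - {\<sigma>}) retract_of geom_realization \<Delta> - {barycenter \<sigma>}"
  unfolding retract_of_def retraction_def
proof (intro exI[of _ "push_off \<sigma>"] conjI ballI)
  have "1 - real (card \<sigma>) * min_coord \<sigma> x \<noteq> 0" if "x \<in> geom_realization \<Delta> - {barycenter \<sigma>}" for x
    using card_mult_min_coord_less_1[of x \<sigma>] that nonempty
    by (auto simp: mem_geom_realization_iff[OF complex])
  then show "continuous_on (geom_realization \<Delta> - {barycenter \<sigma>}) (push_off \<sigma>)"
    unfolding push_off_def min_coord_def
    by (intro continuous_intros continuous_on_Min nonempty) auto
  show "geom_realization (\<Delta> - {\<sigma>}) \<subseteq> geom_realization \<Delta> - {barycenter \<sigma>}"
    by (auto simp: mem_geom_realization_iff[OF complex]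
        mem_geom_realization_iff[OF simplicial_complex_remove_maximal_face[OF complex maximal]])
  show "push_off \<sigma> \<in> geom_realization \<Delta> - {barycenter \<sigma>} \<rightarrow> geom_realization (\<Delta> - {\<sigma>})"
    using push_off_in_geom_realization[OF complex maximal nonempty] by blast
  show "push_off \<sigma> x = x" if "x \<in> geom_realization (\<Delta> - {\<sigma>})" for x
    using that by (rule push_off_eq_self[OF _ complex maximal])
qed

lemma acyclic_on_sphere_remove_maximal_face:
  fixes \<Delta> :: "'v::{finite,linorder} set set"
  assumes complex: "simplicial_complex \<Delta>"
    and sphere: "geom_realization \<Delta> homeomorphic sphere (c::'b::euclidean_space) r" "r > 0"
    and maximal: "maximal_face \<Delta> \<sigma>"
  shows "acyclic_on (\<Delta> - {\<sigma>})"
proof (rule acyclic_on_contractible_complex)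
  show "simplicial_complex (\<Delta> - {\<sigma>})"
    by (rule simplicial_complex_remove_maximal_face[OF complex maximal])
  have "\<sigma> \<noteq> {}"
    using card_maximal_face_sphere[OF complex sphere maximal] by auto
  then have barycenter: "barycenter \<sigma> \<in> geom_realization \<Delta>"
    using barycenter_in_geom_realization maximal_faceD(1)[OF maximal] by blast
  have retract: "geom_realization (\<Delta> - {\<sigma>}) retract_of geom_realization \<Delta> - {barycenter \<sigma>}"
    by (rule retract_punctured_geom_realization[OF complex maximal \<open>\<sigma> \<noteq> {}\<close>])
  obtain A :: "'b set" where chart: "affine A" "A \<noteq> {}"
      "geom_realization \<Delta> - {barycenter \<sigma>} homeomorphic A"
    using punctured_homeomorphic_affine[OF sphere barycenter] by blast
  have "contractible A"
    by (intro convex_imp_contractible affine_imp_convex chart)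
  then show "contractible (geom_realization (\<Delta> - {\<sigma>}))"
    using chart(3) retract retract_of_contractible homeomorphic_contractible_eq by blast
  have "geom_realization \<Delta> - {barycenter \<sigma>} \<noteq> {}"
    using chart(2,3) homeomorphic_empty(2) by metis
  then show "geom_realization (\<Delta> - {\<sigma>}) \<noteq> {}"
    using retract by (auto simp: retract_of_def retraction_def)
qed

subsection \<open>Integral chains as finitely supported functions\<close>

lemma ex_lookup_eq: "\<exists>c. Poly_Mapping.lookup c = (f :: 'a::finite \<Rightarrow> int)"
  by (rule exI[of _ "Abs_poly_mapping f"]) (simp add: Abs_poly_mapping_inverse)

lemma lookup_frag_extend:
  fixes c :: "'a::finite \<Rightarrow>\<^sub>0 int"
  shows "Poly_Mapping.lookup (frag_extend f c) b =
    (\<Sum>a\<in>UNIV. Poly_Mapping.lookup c a * Poly_Mapping.lookup (f a) b)"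
  unfolding frag_extend_def lookup_sum lookup_frag_cmul
  by (rule sum.mono_neutral_left) (auto simp: in_keys_iff)

lemma lookup_in_chains_iff: "Poly_Mapping.lookup c \<in> chains \<Delta> i \<longleftrightarrow> c \<in> frag_chains \<Delta> (Suc i)"
  by (auto simp: chains_def frag_chains_def faces_def in_keys_iff)

lemma lower_faces_Suc: "lower_faces \<Delta> (Suc i) = faces \<Delta> i"
  by (auto simp: lower_faces_def faces_def)

lemma bdry_coeff_nonzeroD:
  assumes "simplicial_complex \<Delta>" "\<sigma> \<in> faces \<Delta> i" "bdry_coeff \<sigma> \<tau> \<noteq> 0"
  shows "\<tau> \<in> lower_faces \<Delta> i"
  using assms
  by (auto simp: bdry_coeff_def faces_def lower_faces_def simplicial_complex_def split: if_splits)

lemma boundary_lookup: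
  fixes \<Delta> :: "'v::{finite,linorder} set set"
  assumes complex: "simplicial_complex \<Delta>" and chain: "c \<in> frag_chains \<Delta> (Suc i)"
  shows "boundary \<Delta> i (Poly_Mapping.lookup c) = Poly_Mapping.lookup (bd c)"
proof
  fix \<tau>
  have "Poly_Mapping.lookup (bd c) \<tau> = (\<Sum>\<sigma>\<in>faces \<Delta> i. bdry_coeff \<sigma> \<tau> * Poly_Mapping.lookup c \<sigma>)"
    unfolding lookup_frag_extend lookup_cell_bd
    by (rule sum.mono_neutral_cong_right)
      (use chain in \<open>auto simp: chains_def simp flip: lookup_in_chains_iff\<close>)
  moreover have "(\<Sum>\<sigma>\<in>faces \<Delta> i. bdry_coeff \<sigma> \<tau> * Poly_Mapping.lookup c \<sigma>) = 0" if "\<tau> \<notin> lower_faces \<Delta> i"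
    using bdry_coeff_nonzeroD[OF complex] that by (intro sum.neutral) auto
  ultimately show "boundary \<Delta> i (Poly_Mapping.lookup c) \<tau> = Poly_Mapping.lookup (bd c) \<tau>"
    by (simp add: boundary_def)
qed

lemma lookup_in_cycles_iff:
  fixes \<Delta> :: "'v::{finite,linorder} set set"
  assumes "simplicial_complex \<Delta>"
  shows "Poly_Mapping.lookup c \<in> cycles \<Delta> i \<longleftrightarrow> c \<in> frag_chains \<Delta> (Suc i) \<and> bd c = 0"
  using boundary_lookup[OF assms, of c i]
  by (auto simp: cycles_def lookup_in_chains_iff fun_eq_iff intro!: poly_mapping_eqI)

lemma boundary_in_cycles:
  fixes \<Delta> :: "'v::{finite,linorder} set set"
  assumes complex: "simplicial_complex \<Delta>" and chain: "x \<in> chains \<Delta> (Suc i)"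
  shows "boundary \<Delta> (Suc i) x \<in> cycles \<Delta> i"
proof -
  obtain c where lookup_c: "Poly_Mapping.lookup c = x"
    using ex_lookup_eq by blast
  then have "c \<in> frag_chains \<Delta> (Suc (Suc i))"
    using chain lookup_in_chains_iff by blast
  then show ?thesis
    using boundary_lookup[OF complex] bd_in_frag_chains[OF subcomplex_if_simplicial_complex[OF complex]]
    by (simp add: lookup_in_cycles_iff[OF complex] flip: lookup_c)
qed

lemma boundary_diff: "boundary \<Delta> i (\<lambda>\<sigma>. x \<sigma> - y \<sigma>) = (\<lambda>\<tau>. boundary \<Delta> i x \<tau> - boundary \<Delta> i y \<tau>)"
  by (auto simp: boundary_def right_diff_distrib sum_subtractf)

lemma boundary_add: "boundary \<Delta> i (\<lambda>\<sigma>. x \<sigma> + y \<sigma>) = (\<lambda>\<tau>. boundary \<Delta> i x \<tau> + boundary \<Delta> i y \<tau>)"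
  by (auto simp: boundary_def distrib_left sum.distrib)

lemma boundary_scale: "boundary \<Delta> i (\<lambda>\<sigma>. k * x \<sigma>) = (\<lambda>\<tau>. k * boundary \<Delta> i x \<tau>)"
  by (auto simp: boundary_def sum_distrib_left mult_ac intro!: sum.cong)

lemma coboundary_in_chains: "coboundary \<Delta> i u \<in> chains \<Delta> i"
  by (auto simp: coboundary_def chains_def)

lemma coboundary_adjoint:
  "(\<Sum>\<sigma>\<in>faces \<Delta> i. x \<sigma> * coboundary \<Delta> i u \<sigma>) = (\<Sum>\<tau>\<in>lower_faces \<Delta> i. boundary \<Delta> i x \<tau> * u \<tau>)"
proof -
  have "(\<Sum>\<sigma>\<in>faces \<Delta> i. x \<sigma> * coboundary \<Delta> i u \<sigma>) =
      (\<Sum>\<sigma>\<in>faces \<Delta> i. \<Sum>\<tau>\<in>lower_faces \<Delta> i. x \<sigma> * bdry_coeff \<sigma> \<tau> * u \<tau>)"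
    by (simp add: coboundary_def sum_distrib_left mult_ac)
  also have "\<dots> = (\<Sum>\<tau>\<in>lower_faces \<Delta> i. \<Sum>\<sigma>\<in>faces \<Delta> i. x \<sigma> * bdry_coeff \<sigma> \<tau> * u \<tau>)"
    by (rule sum.swap)
  finally show ?thesis
    by (simp add: boundary_def sum_distrib_left sum_distrib_right mult_ac)
qed

abbreviation cycle_group :: "'v::linorder set set \<Rightarrow> nat \<Rightarrow> ('v set \<Rightarrow> int) monoid" where
  "cycle_group \<Delta> i \<equiv> (chain_group \<Delta> i)\<lparr>carrier := cycles \<Delta> i\<rparr>"

lemma cycles_linear:
  shows "(\<lambda>_. 0) \<in> cycles \<Delta> i"
    and "x \<in> cycles \<Delta> i \<Longrightarrow> y \<in> cycles \<Delta> i \<Longrightarrow> (\<lambda>\<sigma>. x \<sigma> + y \<sigma>) \<in> cycles \<Delta> i"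
    and "x \<in> cycles \<Delta> i \<Longrightarrow> y \<in> cycles \<Delta> i \<Longrightarrow> (\<lambda>\<sigma>. x \<sigma> - y \<sigma>) \<in> cycles \<Delta> i"
    and "x \<in> cycles \<Delta> i \<Longrightarrow> (\<lambda>\<sigma>. k * x \<sigma>) \<in> cycles \<Delta> i"
  by (auto simp: cycles_def chains_def boundary_add boundary_diff boundary_scale)
    (auto simp: boundary_def)

lemma group_cycle_group: "group (cycle_group \<Delta> i)"
proof (rule groupI)
  fix x assume cycle: "x \<in> carrier (cycle_group \<Delta> i)"
  then have "(\<lambda>\<sigma>. - x \<sigma>) \<in> cycles \<Delta> i"
    using cycles_linear(4)[of x \<Delta> i "-1"] by simp
  then show "\<exists>y\<in>carrier (cycle_group \<Delta> i). y \<otimes>\<^bsub>cycle_group \<Delta> i\<^esub> x = \<one>\<^bsub>cycle_group \<Delta> i\<^esub>"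
    by (intro bexI[of _ "\<lambda>\<sigma>. - x \<sigma>"]) (auto simp: chain_group_def)
qed (use cycles_linear in \<open>auto simp: chain_group_def add.assoc\<close>)

lemma coboundary_sum_lookup:
  fixes \<Delta> :: "'v::{finite,linorder} set set"
  assumes "simplicial_complex \<Delta>" "\<sigma> \<in> faces \<Delta> i"
  shows "coboundary \<Delta> i (\<lambda>\<tau>. \<Sum>\<rho>\<in>R. x \<rho> * Poly_Mapping.lookup (h \<tau>) \<rho>) \<sigma> =
    (\<Sum>\<rho>\<in>R. x \<rho> * Poly_Mapping.lookup (frag_extend h (cell_bd \<sigma>)) \<rho>)"
proof -
  have lookup_extend: "(\<Sum>\<tau>\<in>lower_faces \<Delta> i. bdry_coeff \<sigma> \<tau> * Poly_Mapping.lookup (h \<tau>) \<rho>) =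
      Poly_Mapping.lookup (frag_extend h (cell_bd \<sigma>)) \<rho>" for \<rho>
    unfolding lookup_frag_extend lookup_cell_bd
    by (rule sum.mono_neutral_left) (use bdry_coeff_nonzeroD[OF assms] in auto)
  have "coboundary \<Delta> i (\<lambda>\<tau>. \<Sum>\<rho>\<in>R. x \<rho> * Poly_Mapping.lookup (h \<tau>) \<rho>) \<sigma> =
      (\<Sum>\<tau>\<in>lower_faces \<Delta> i. \<Sum>\<rho>\<in>R. x \<rho> * (bdry_coeff \<sigma> \<tau> * Poly_Mapping.lookup (h \<tau>) \<rho>))"
    using assms(2) by (simp add: coboundary_def sum_distrib_left mult_ac)
  also have "\<dots> = (\<Sum>\<rho>\<in>R. x \<rho> * (\<Sum>\<tau>\<in>lower_faces \<Delta> i. bdry_coeff \<sigma> \<tau> * Poly_Mapping.lookup (h \<tau>) \<rho>))"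
    by (subst sum.swap) (simp add: sum_distrib_left)
  finally show ?thesis
    by (simp add: lookup_extend)
qed

subsection \<open>Complexes with acyclic facet complements\<close>

locale acyclic_facet_complements =
  fixes \<Delta> :: "'v::{finite,linorder} set set" and i :: nat
  assumes complex: "simplicial_complex \<Delta>"
    and dim: "\<sigma> \<in> \<Delta> \<Longrightarrow> card \<sigma> \<le> Suc (Suc i)"
    and facets_nonempty: "faces \<Delta> (Suc i) \<noteq> {}"
    and acyclic: "\<sigma> \<in> faces \<Delta> (Suc i) \<Longrightarrow> acyclic_on (\<Delta> - {\<sigma>})"
begin

abbreviation facets :: "'v set set" where
  "facets \<equiv> faces \<Delta> (Suc i)"

abbreviation pairing :: "('v set \<Rightarrow> int) \<Rightarrow> ('v set \<Rightarrow> int) \<Rightarrow> int" where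
  "pairing x y \<equiv> (\<Sum>\<sigma>\<in>facets. x \<sigma> * y \<sigma>)"

lemma facetD:
  assumes "\<sigma> \<in> facets"
  shows "\<sigma> \<in> \<Delta>" "card \<sigma> = Suc (Suc i)"
  using assms by (auto simp: faces_def)

lemma cycle_bounds_avoiding_facet:
  assumes facet: "\<sigma>0 \<in> facets" and cycle: "x \<in> cycles \<Delta> i"
  obtains e where "e \<in> chains \<Delta> (Suc i)" "e \<sigma>0 = 0" "boundary \<Delta> (Suc i) e = x"
proof -
  obtain c where lookup_c: "Poly_Mapping.lookup c = x"
    using ex_lookup_eq by blast
  then have "c \<in> frag_chains \<Delta> (Suc i)" "bd c = 0"
    using cycle lookup_in_cycles_iff[OF complex] by blast+
  moreover from this have "c \<in> frag_chains (\<Delta> - {\<sigma>0}) (Suc i)"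
    using facetD(2)[OF facet] by (auto simp: frag_chains_def)
  ultimately obtain e where filling: "e \<in> frag_chains (\<Delta> - {\<sigma>0}) (Suc (Suc i))" "bd e = c"
    using acyclic_inD[OF acyclic[OF facet]] by blast
  then have filling_chain: "e \<in> frag_chains \<Delta> (Suc (Suc i))"
    by (auto intro: frag_chains_mono)
  show thesis
  proof
    show "Poly_Mapping.lookup e \<in> chains \<Delta> (Suc i)"
      using filling_chain by (simp add: lookup_in_chains_iff)
    show "Poly_Mapping.lookup e \<sigma>0 = 0"
      using filling(1) by (auto simp: frag_chains_def in_keys_iff)
    show "boundary \<Delta> (Suc i) (Poly_Mapping.lookup e) = x"
      using boundary_lookup[OF complex filling_chain] filling(2) lookup_c by simp
  qed
qed

lemma cycle_bounds:
  assumes "x \<in> cycles \<Delta> i"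
  obtains e where "e \<in> chains \<Delta> (Suc i)" "x = boundary \<Delta> (Suc i) e"
proof -
  obtain \<sigma>0 where "\<sigma>0 \<in> facets"
    using facets_nonempty by blast
  from cycle_bounds_avoiding_facet[OF this assms] show thesis
    using that by blast
qed

lemma cycle_avoiding_facet_eq_zero:
  assumes facet: "\<sigma>0 \<in> facets" and cycle: "x \<in> cycles \<Delta> (Suc i)" "x \<sigma>0 = 0"
  shows "x = (\<lambda>_. 0)"
proof -
  obtain c where lookup_c: "Poly_Mapping.lookup c = x"
    using ex_lookup_eq by blast
  then have "c \<in> frag_chains \<Delta> (Suc (Suc i))" "bd c = 0"
    using cycle(1) lookup_in_cycles_iff[OF complex] by blast+
  moreover from this have "c \<in> frag_chains (\<Delta> - {\<sigma>0}) (Suc (Suc i))"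
    using lookup_c cycle(2) by (auto simp: frag_chains_def in_keys_iff)
  ultimately obtain e where filling: "e \<in> frag_chains (\<Delta> - {\<sigma>0}) (Suc (Suc (Suc i)))" "bd e = c"
    using acyclic_inD[OF acyclic[OF facet]] by blast
  have "e = 0"
    by (rule frag_chains_eq_zero[OF filling(1)]) (use dim in fastforce)
  then show ?thesis
    using filling(2) lookup_c by auto
qed

lemma boundary_left_inverse_off_facet:
  assumes facet: "\<sigma>0 \<in> facets"
  obtains h where "\<And>\<sigma>. \<sigma> \<in> facets - {\<sigma>0} \<Longrightarrow> frag_extend h (cell_bd \<sigma>) = frag_of \<sigma>"
proof -
  let ?L = "\<Delta> - {\<sigma>0}"
  have "maximal_face \<Delta> \<sigma>0"
    using facetD[OF facet] dim by (intro maximal_face_if_card_maximal) auto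
  then have "subcomplex ?L"
    by (intro subcomplex_if_simplicial_complex simplicial_complex_remove_maximal_face complex)
  then obtain h where homotopy: "carried_homotopy ?L (\<lambda>_. ?L) frag_of (\<lambda>_. 0) h"
    using acyclic_on_iff_contracting_homotopy acyclic[OF facet] by blast
  have "frag_extend h (cell_bd \<sigma>) = frag_of \<sigma>" if "\<sigma> \<in> facets - {\<sigma>0}" for \<sigma>
  proof -
    have "h \<sigma> \<in> frag_chains ?L (Suc (Suc (Suc i)))"
      "bd (h \<sigma>) = frag_of \<sigma> - frag_extend h (cell_bd \<sigma>)"
      using homotopy[unfolded carried_homotopy_def, rule_format, of \<sigma>] facetD[of \<sigma>] that by auto
    moreover from this(1) have "h \<sigma> = 0"
      by (rule frag_chains_eq_zero) (use dim in fastforce)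
    ultimately show ?thesis
      by simp
  qed
  then show thesis
    by (rule that)
qed

lemma coboundary_arbitrary_off_facet:
  assumes facet: "\<sigma>0 \<in> facets"
  obtains u where "u \<in> chains \<Delta> i" "\<And>\<sigma>. \<sigma> \<in> facets - {\<sigma>0} \<Longrightarrow> coboundary \<Delta> (Suc i) u \<sigma> = x \<sigma>"
proof -
  obtain h where left_inverse: "\<And>\<sigma>. \<sigma> \<in> facets - {\<sigma>0} \<Longrightarrow> frag_extend h (cell_bd \<sigma>) = frag_of \<sigma>"
    using boundary_left_inverse_off_facet[OF facet] by blast
  let ?v = "\<lambda>\<tau>. \<Sum>\<rho>\<in>facets. x \<rho> * Poly_Mapping.lookup (h \<tau>) \<rho>"
  define u where "u \<tau> = (if \<tau> \<in> faces \<Delta> i then ?v \<tau> else 0)" for \<tau>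
  have "coboundary \<Delta> (Suc i) u \<sigma> = x \<sigma>" if other_facet: "\<sigma> \<in> facets - {\<sigma>0}" for \<sigma>
  proof -
    have "coboundary \<Delta> (Suc i) u \<sigma> = coboundary \<Delta> (Suc i) ?v \<sigma>"
      by (simp add: coboundary_def lower_faces_Suc u_def)
    also have "\<dots> = (\<Sum>\<rho>\<in>facets. x \<rho> * Poly_Mapping.lookup (frag_of \<sigma>) \<rho>)"
      unfolding coboundary_sum_lookup[OF complex DiffD1[OF other_facet]] left_inverse[OF other_facet] ..
    also have "\<dots> = (\<Sum>\<rho>\<in>facets. if \<rho> = \<sigma> then x \<rho> else 0)"
      by (rule sum.cong) (auto simp: lookup_single when_def)
    also have "\<dots> = x \<sigma>"
      using other_facet by simp
    finally show ?thesis .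
  qed
  moreover have "u \<in> chains \<Delta> i"
    by (auto simp: u_def chains_def)
  ultimately show thesis
    using that by blast
qed

lemma cycle_with_unit_coefficient:
  assumes "\<sigma>0 \<in> facets"
  obtains z where "z \<in> cycles \<Delta> (Suc i)" "z \<sigma>0 = 1"
proof -
  let ?s = "\<lambda>\<sigma>. if \<sigma> = \<sigma>0 then 1 else (0::int)"
  have indicator_chain: "?s \<in> chains \<Delta> (Suc i)"
    using assms by (auto simp: chains_def)
  obtain e where "e \<in> chains \<Delta> (Suc i)" "e \<sigma>0 = 0" "boundary \<Delta> (Suc i) e = boundary \<Delta> (Suc i) ?s"
    using cycle_bounds_avoiding_facet[OF assms boundary_in_cycles[OF complex indicator_chain]]
    by blast
  then show thesis
    using that[of "\<lambda>\<sigma>. ?s \<sigma> - e \<sigma>"] indicator_chain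
    by (auto simp: cycles_def boundary_diff chains_def)
qed

lemma cycle_eq_scaled_cycle:
  assumes facet: "\<sigma>0 \<in> facets" and unit_cycle: "z \<in> cycles \<Delta> (Suc i)" "z \<sigma>0 * z \<sigma>0 = 1"
    and cycle: "y \<in> cycles \<Delta> (Suc i)"
  shows "y = (\<lambda>\<sigma>. y \<sigma>0 * z \<sigma>0 * z \<sigma>)"
proof
  fix \<sigma>
  have "(\<lambda>\<sigma>. y \<sigma> - y \<sigma>0 * z \<sigma>0 * z \<sigma>) = (\<lambda>_. 0)"
  proof (rule cycle_avoiding_facet_eq_zero[OF facet])
    show "(\<lambda>\<sigma>. y \<sigma> - y \<sigma>0 * z \<sigma>0 * z \<sigma>) \<in> cycles \<Delta> (Suc i)"
      by (intro cycles_linear(3,4) cycle unit_cycle(1))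
  qed (simp add: mult.assoc unit_cycle(2))
  from fun_cong[OF this, of \<sigma>] show "y \<sigma> = y \<sigma>0 * z \<sigma>0 * z \<sigma>"
    by simp
qed

definition fundamental_cycle :: "('v set \<Rightarrow> int) \<Rightarrow> bool" where
  "fundamental_cycle z \<longleftrightarrow> z \<in> cycles \<Delta> (Suc i) \<and> (\<forall>\<sigma>\<in>facets. z \<sigma> * z \<sigma> = 1)"

lemma fundamental_cycle_exists: "\<exists>z. fundamental_cycle z"
proof -
  obtain \<sigma>0 where facet: "\<sigma>0 \<in> facets"
    using facets_nonempty by blast
  obtain z where unit_cycle: "z \<in> cycles \<Delta> (Suc i)" "z \<sigma>0 = 1"
    using cycle_with_unit_coefficient[OF facet] by blast
  have "z \<sigma> * z \<sigma> = 1" if "\<sigma> \<in> facets" for \<sigma>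
  proof -
    obtain y where cycle: "y \<in> cycles \<Delta> (Suc i)" "y \<sigma> = 1"
      using cycle_with_unit_coefficient[OF \<open>\<sigma> \<in> facets\<close>] by blast
    have "y \<sigma>0 * z \<sigma> = 1"
      using fun_cong[OF cycle_eq_scaled_cycle[OF facet unit_cycle(1) _ cycle(1)], of \<sigma>] cycle(2) unit_cycle(2)
      by simp
    then show ?thesis
      by (auto simp: zmult_eq_1_iff)
  qed
  then show ?thesis
    using unit_cycle(1) by (auto simp: fundamental_cycle_def)
qed

context
  fixes z :: "'v set \<Rightarrow> int"
  assumes fundamental: "fundamental_cycle z"
begin

lemma fundamental_cycle_in_cycles: "z \<in> cycles \<Delta> (Suc i)"
  and fundamental_cycle_boundary: "boundary \<Delta> (Suc i) z = (\<lambda>_. 0)"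
  and fundamental_cycle_square: "\<sigma> \<in> facets \<Longrightarrow> z \<sigma> * z \<sigma> = 1"
  using fundamental by (auto simp: fundamental_cycle_def cycles_def)

lemma pairing_fundamental_cycle: "pairing z z = int (card facets)"
  by (simp add: fundamental_cycle_square)

lemma pairing_coboundary_eq_zero: "pairing z (coboundary \<Delta> (Suc i) u) = 0"
  by (simp add: coboundary_adjoint fundamental_cycle_boundary)

lemma orthogonal_fundamental_cycle_is_coboundary:
  assumes orthogonal: "x \<in> chains \<Delta> (Suc i)" "pairing z x = 0"
  obtains u where "u \<in> chains \<Delta> i" "coboundary \<Delta> (Suc i) u = x"
proof -
  obtain \<sigma>0 where facet: "\<sigma>0 \<in> facets"
    using facets_nonempty by blast
  obtain u where cochain: "u \<in> chains \<Delta> i"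
    and coboundary_off_facet: "\<And>\<sigma>. \<sigma> \<in> facets - {\<sigma>0} \<Longrightarrow> coboundary \<Delta> (Suc i) u \<sigma> = x \<sigma>"
    using coboundary_arbitrary_off_facet[OF facet] by blast
  define defect where "defect \<sigma> = coboundary \<Delta> (Suc i) u \<sigma> - x \<sigma>" for \<sigma>
  have "pairing z defect = 0"
    using pairing_coboundary_eq_zero[of u] orthogonal(2)
    by (simp add: defect_def right_diff_distrib sum_subtractf)
  moreover have "pairing z defect = (\<Sum>\<sigma>\<in>facets. if \<sigma> = \<sigma>0 then z \<sigma>0 * defect \<sigma>0 else 0)"
    by (rule sum.cong) (auto simp: defect_def coboundary_off_facet)
  ultimately have "defect \<sigma>0 = 0"
    using facet fundamental_cycle_square[OF facet] by auto
  have "coboundary \<Delta> (Suc i) u \<sigma> = x \<sigma>" for \<sigma>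
  proof -
    consider "\<sigma> = \<sigma>0" | "\<sigma> \<in> facets - {\<sigma>0}" | "\<sigma> \<notin> facets"
      by blast
    then show ?thesis
    proof cases
      case 1
      with \<open>defect \<sigma>0 = 0\<close> show ?thesis
        by (simp add: defect_def)
    next
      case 2
      then show ?thesis
        by (rule coboundary_off_facet)
    next
      case 3
      with orthogonal(1) show ?thesis
        by (simp add: coboundary_def chains_def)
    qed
  qed
  with cochain show thesis
    using that by blast
qed

lemma pairing_mod_card_facets_cong:
  assumes "x \<in> chains \<Delta> (Suc i)" "y \<in> chains \<Delta> (Suc i)"
    and "boundary \<Delta> (Suc i) x = boundary \<Delta> (Suc i) y"
  shows "pairing z x mod int (card facets) = pairing z y mod int (card facets)"
proof -
  obtain \<sigma>0 where facet: "\<sigma>0 \<in> facets"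
    using facets_nonempty by blast
  have "(\<lambda>\<sigma>. x \<sigma> - y \<sigma>) \<in> cycles \<Delta> (Suc i)"
    using assms by (auto simp: cycles_def chains_def boundary_diff)
  then obtain k where "(\<lambda>\<sigma>. x \<sigma> - y \<sigma>) = (\<lambda>\<sigma>. k * z \<sigma>)"
    using cycle_eq_scaled_cycle[OF facet fundamental_cycle_in_cycles fundamental_cycle_square[OF facet]]
    by blast
  then have "\<And>\<sigma>. x \<sigma> = y \<sigma> + k * z \<sigma>"
    by (auto simp: fun_eq_iff algebra_simps)
  then have "pairing z x = pairing z y + k * pairing z z"
    by (simp add: distrib_left sum.distrib sum_distrib_left mult_ac)
  then show ?thesis
    by (simp add: pairing_fundamental_cycle)
qed

definition filling_degree :: "('v set \<Rightarrow> int) \<Rightarrow> int" where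
  "filling_degree x =
     pairing z (SOME e. e \<in> chains \<Delta> (Suc i) \<and> boundary \<Delta> (Suc i) e = x) mod int (card facets)"

lemma filling_degree_boundary:
  assumes "e \<in> chains \<Delta> (Suc i)"
  shows "filling_degree (boundary \<Delta> (Suc i) e) = pairing z e mod int (card facets)"
proof -
  have "\<exists>e'. e' \<in> chains \<Delta> (Suc i) \<and> boundary \<Delta> (Suc i) e' = boundary \<Delta> (Suc i) e"
    using assms by blast
  from someI_ex[OF this] show ?thesis
    unfolding filling_degree_def using assms by (intro pairing_mod_card_facets_cong) auto
qed

lemma filling_degree_hom:
  "filling_degree \<in> hom (cycle_group \<Delta> i) (integer_mod_group (card facets))"
proof (rule homI)
  show "filling_degree x \<in> carrier (integer_mod_group (card facets))" for x
    using facets_nonempty by (auto simp: filling_degree_def carrier_integer_mod_group card_gt_0_iff)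
  fix x y assume "x \<in> carrier (cycle_group \<Delta> i)" "y \<in> carrier (cycle_group \<Delta> i)"
  then have "x \<in> cycles \<Delta> i" "y \<in> cycles \<Delta> i"
    by simp_all
  then obtain a b where fillings: "a \<in> chains \<Delta> (Suc i)" "x = boundary \<Delta> (Suc i) a"
      "b \<in> chains \<Delta> (Suc i)" "y = boundary \<Delta> (Suc i) b"
    using cycle_bounds by metis
  then have "x \<otimes>\<^bsub>cycle_group \<Delta> i\<^esub> y = boundary \<Delta> (Suc i) (\<lambda>\<sigma>. a \<sigma> + b \<sigma>)"
      "(\<lambda>\<sigma>. a \<sigma> + b \<sigma>) \<in> chains \<Delta> (Suc i)"
    by (auto simp: chain_group_def boundary_add chains_def)
  then have "filling_degree (x \<otimes>\<^bsub>cycle_group \<Delta> i\<^esub> y) =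
      (pairing z a + pairing z b) mod int (card facets)"
    by (simp add: filling_degree_boundary distrib_left sum.distrib)
  then show "filling_degree (x \<otimes>\<^bsub>cycle_group \<Delta> i\<^esub> y) =
      filling_degree x \<otimes>\<^bsub>integer_mod_group (card facets)\<^esub> filling_degree y"
    using fillings by (simp add: filling_degree_boundary mod_add_eq)
qed

lemma filling_degree_surj:
  "filling_degree ` carrier (cycle_group \<Delta> i) = carrier (integer_mod_group (card facets))"
proof
  show "filling_degree ` carrier (cycle_group \<Delta> i) \<subseteq> carrier (integer_mod_group (card facets))"
    using filling_degree_hom by (auto simp: hom_def)
  show "carrier (integer_mod_group (card facets)) \<subseteq> filling_degree ` carrier (cycle_group \<Delta> i)"
  proof
    fix k assume residue: "k \<in> carrier (integer_mod_group (card facets))"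
    obtain \<sigma>0 where facet: "\<sigma>0 \<in> facets"
      using facets_nonempty by blast
    let ?e = "\<lambda>\<sigma>. if \<sigma> = \<sigma>0 then k * z \<sigma>0 else 0"
    have chain: "?e \<in> chains \<Delta> (Suc i)"
      using facet by (auto simp: chains_def)
    have "pairing z ?e = (\<Sum>\<sigma>\<in>facets. if \<sigma> = \<sigma>0 then k else 0)"
      by (rule sum.cong) (use fundamental_cycle_square[OF facet] in \<open>auto simp: mult.left_commute\<close>)
    then have "pairing z ?e = k"
      using facet by simp
    then have "filling_degree (boundary \<Delta> (Suc i) ?e) = k"
      using filling_degree_boundary[OF chain] residue facets_nonempty
      by (simp add: carrier_integer_mod_group)
    moreover have "boundary \<Delta> (Suc i) ?e \<in> carrier (cycle_group \<Delta> i)"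
      using boundary_in_cycles[OF complex chain] by simp
    ultimately show "k \<in> filling_degree ` carrier (cycle_group \<Delta> i)"
      by (rule image_eqI[OF sym])
  qed
qed

lemma kernel_filling_degree:
  "kernel (cycle_group \<Delta> i) (integer_mod_group (card facets)) filling_degree = laplacian_image \<Delta> i"
proof (intro equalityI subsetI)
  fix x assume "x \<in> kernel (cycle_group \<Delta> i) (integer_mod_group (card facets)) filling_degree"
  then have "x \<in> cycles \<Delta> i" "filling_degree x = 0"
    by (auto simp: kernel_def)
  then obtain e where filling: "e \<in> chains \<Delta> (Suc i)" "x = boundary \<Delta> (Suc i) e"
    using cycle_bounds by blast
  then obtain k where degree_multiple: "pairing z e = int (card facets) * k"
    using \<open>filling_degree x = 0\<close> filling_degree_boundary by auto
  let ?e = "\<lambda>\<sigma>. e \<sigma> - k * z \<sigma>"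
  have "?e \<in> chains \<Delta> (Suc i)"
    using filling fundamental_cycle_in_cycles by (auto simp: cycles_def chains_def)
  moreover have "pairing z ?e = pairing z e - k * pairing z z"
    by (simp add: right_diff_distrib sum_subtractf sum_distrib_left mult_ac)
  then have "pairing z ?e = 0"
    using degree_multiple pairing_fundamental_cycle by simp
  ultimately obtain u where cochain: "u \<in> chains \<Delta> i" "coboundary \<Delta> (Suc i) u = ?e"
    using orthogonal_fundamental_cycle_is_coboundary by blast
  have "boundary \<Delta> (Suc i) (coboundary \<Delta> (Suc i) u) = x"
    using filling by (simp add: cochain(2) boundary_diff boundary_scale fundamental_cycle_boundary)
  then show "x \<in> laplacian_image \<Delta> i"
    using cochain(1) by (auto simp: laplacian_image_def)
next
  fix x assume "x \<in> laplacian_image \<Delta> i"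
  then obtain u where cochain: "x = boundary \<Delta> (Suc i) (coboundary \<Delta> (Suc i) u)"
    by (auto simp: laplacian_image_def)
  then have "filling_degree x = 0" "x \<in> cycles \<Delta> i"
    using boundary_in_cycles[OF complex]
    by (simp_all add: filling_degree_boundary pairing_coboundary_eq_zero coboundary_in_chains)
  then show "x \<in> kernel (cycle_group \<Delta> i) (integer_mod_group (card facets)) filling_degree"
    by (simp add: kernel_def)
qed

end

theorem critical_group_iso_integer_mod_group: "critical_group \<Delta> i \<cong> integer_mod_group (card facets)"
proof -
  obtain z where fundamental: "fundamental_cycle z"
    using fundamental_cycle_exists by blast
  interpret group_hom "cycle_group \<Delta> i" "integer_mod_group (card facets)" "filling_degree z"
    using group_cycle_group filling_degree_hom[OF fundamental]
    by (simp add: group_hom_def group_hom_axioms_def)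
  show ?thesis
    using FactGroup_iso[OF filling_degree_surj[OF fundamental]]
    by (simp add: critical_group_def kernel_filling_degree[OF fundamental])
qed

end

lemma acyclic_facet_complements_sphere:
  fixes \<Delta> :: "'v::{finite,linorder} set set" and c :: "'b::euclidean_space"
  assumes complex: "simplicial_complex \<Delta>"
    and sphere: "geom_realization \<Delta> homeomorphic sphere c r" "r > 0"
    and DIM_eq: "DIM('b) = Suc (Suc i)"
  shows "acyclic_facet_complements \<Delta> i"
proof
  have card_maximal: "card \<tau> = Suc (Suc i)" if "maximal_face \<Delta> \<tau>" for \<tau>
    using card_maximal_face_sphere[OF complex sphere that] DIM_eq by simp
  have facet_superset: "\<exists>\<tau>\<in>faces \<Delta> (Suc i). \<sigma> \<subseteq> \<tau>" if "\<sigma> \<in> \<Delta>" for \<sigma>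
  proof -
    obtain \<tau> where "maximal_face \<Delta> \<tau>" "\<sigma> \<subseteq> \<tau>"
      using maximal_face_superset[OF \<open>\<sigma> \<in> \<Delta>\<close>] by blast
    then show ?thesis
      using card_maximal[of \<tau>] maximal_faceD(1)[of \<Delta> \<tau>] by (auto simp: faces_def)
  qed
  show dim: "card \<sigma> \<le> Suc (Suc i)" if "\<sigma> \<in> \<Delta>" for \<sigma>
  proof -
    obtain \<tau> where "card \<tau> = Suc (Suc i)" "\<sigma> \<subseteq> \<tau>"
      using facet_superset[OF \<open>\<sigma> \<in> \<Delta>\<close>] by (auto simp: faces_def)
    then show ?thesis
      using card_mono[of \<tau> \<sigma>] by simp
  qed
  have "geom_realization \<Delta> \<noteq> {}"
    using sphere homeomorphic_empty(2) by fastforce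
  then show "faces \<Delta> (Suc i) \<noteq> {}"
    using facet_superset by (auto simp: geom_realization_def)
  show "acyclic_on (\<Delta> - {\<sigma>})" if "\<sigma> \<in> faces \<Delta> (Suc i)" for \<sigma>
    by (rule acyclic_on_sphere_remove_maximal_face[OF complex sphere maximal_face_if_card_maximal])
      (use that dim in \<open>auto simp: faces_def\<close>)
qed (rule complex)

theorem mainTheorem9:
  fixes \<Sigma> :: "('v::{finite,linorder}) set set" and d n :: nat
  assumes "d \<ge> 1"
    and "simplicial_complex \<Sigma>"
    and "CARD('m::finite) = d + 1"
    and "geom_realization \<Sigma> homeomorphic sphere (0::real^'m) 1"
    and "n = card (faces \<Sigma> d)"
  shows "critical_group \<Sigma> (d - 1) \<cong> integer_mod_group n"
proof -
  obtain i where d_eq: "d = Suc i"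
    using assms(1) by (cases d) auto
  interpret acyclic_facet_complements \<Sigma> i
    using assms(3) d_eq by (intro acyclic_facet_complements_sphere[OF assms(2,4)]) auto
  show ?thesis
    using critical_group_iso_integer_mod_group by (simp add: d_eq assms(5))
qed

end
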